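(* Let $\&$ be a continuous t-norm on $[0,1]$ and let $M=\{a\in[0,1]\mid a\& a\text{ is idempotent}\}$. A stable subconstruct $\mathbf{A}$ of $[0,1]\text{-}\mathbf{Cat}$ is cartesian closed if and only if there is a suitable subset $S$ of $[0,1]^2$ contained in $M^2$ such that $\mathbf{A}=[0,1]\text{-}\mathbf{Cat}_S$. Hence $M\text{-}\mathbf{Cat}$ is the largest cartesian closed and stable subconstruct of $[0,1]\text{-}\mathbf{Cat}$ (i.e. $M\text{-}\mathbf{Cat}$ is a cartesian closed stable subconstruct, and it contains every cartesian closed stable subconstruct).
   Context: A continuous t-norm is a continuous binary operation $\&$ on $[0,1]$ that is commutative, associative, monotone in each variable and has unit $1$. An element $p$ is idempotent if $p\& p=p$. A $[0,1]$-category is a pair $(X,r)$ with $X$ a set and $r:X\times X\to[0,1]$ such that $r(x,x)=1$ and $r(y,z)\& r(x,y)\le r(x,z)$ for all $x,y,z\in X$. A $[0,1]$-functor $f:(X,r)\to(Y,s)$ is a map $f:X\to Y$ with $r(x_1,x_2)\le s(f(x_1),f(x_2))$ for all $x_1,x_2\in X$. $[0,1]$-categories and $[0,1]$-functors form the category $[0,1]\text{-}\mathbf{Cat}$, a construct (concrete category over $\mathbf{Set}$) via the underlying set functor. A subconstruct $\mathbf{A}$ of a construct $\mathbf{B}$ is a subcategory of $\mathbf{B}$ with the restricted forgetful functor. It is concretely reflective (resp. concretely coreflective) if every $\mathbf{B}$-object has an $\mathbf{A}$-reflection (resp. $\mathbf{A}$-coreflection) arrow whose underlying map is an identity. It is stable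 if it is both concretely reflective and concretely coreflective in $\mathbf{B}$. Stable subconstructs of $[0,1]\text{-}\mathbf{Cat}$ are automatically full. A subset $S\subseteq[0,1]^2$ is suitable if: (S1) $S$ is closed under arbitrary (including empty) componentwise joins and meets; (S2) $(a,b)\in S$ implies $(b,a)\in S$; (S3) $(a_1,b_1),(a_2,b_2)\in S$ implies $(a_1\& a_2,b_1\& b_2)\in S$. For a suitable $S$, $[0,1]\text{-}\mathbf{Cat}_S$ is the full subconstruct of $[0,1]\text{-}\mathbf{Cat}$ of all $(X,r)$ with $(r(x,y),r(y,x))\in S$ for all $x,y\in X$. $M\text{-}\mathbf{Cat}$ is the full subcategory of $[0,1]\text{-}\mathbf{Cat}$ of all $(X,r)$ with $r(x,y)\in M$ for all $x,y\in X$. A category is cartesian closed if it has finite products and for each object $A$ the functor $A\times-$ has a right adjoint. *)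

theory Defs
  imports Complex_Main "HOL-Library.FuncSet" "HOL-Library.Equipollence"
begin

section \<open>The ambient universe of sets\<close>

text \<open>
  HOL has no type of all sets, so the base category of sets is the category of all members of a
  Grothendieck universe \<open>U\<close> of subsets of a type \<open>'u\<close>, which is a parameter throughout.
  Since \<open>'u\<close> carries no membership relation, closure under power sets is up to bijection.
  An infinite member is not required, so the finite sets are admitted alongside the
  larger universes.
\<close>

definition set_universe :: "'u set set \<Rightarrow> bool" where
  "set_universe U \<longleftrightarrow>
     (\<exists>X\<in>U. \<exists>x\<in>X. \<exists>y\<in>X. x \<noteq> y) \<and>
     (\<forall>X\<in>U. \<forall>Y. Y \<subseteq> X \<longrightarrow> Y \<in> U) \<and>
     (\<forall>X\<in>U. \<forall>f. f ` X \<in> U) \<and>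
     (\<forall>X\<in>U. \<exists>P\<in>U. P \<approx> Pow X) \<and>
     (\<forall>I\<in>U. \<forall>F. (\<forall>i\<in>I. F i \<in> U) \<longrightarrow> (\<Union>i\<in>I. F i) \<in> U)"

lemma set_universe_finite_sets:
  assumes "infinite (UNIV :: 'u set)"
  shows "set_universe {X :: 'u set. finite X}"
proof -
  have ex: "\<exists>P\<in>{X :: 'u set. finite X}. P \<approx> Pow X" if "finite X" for X :: "'u set"
  proof -
    obtain P :: "'u set" where P: "finite P" "card P = card (Pow X)"
      using infinite_arbitrarily_large[OF assms] by metis
    have "P \<approx> Pow X"
      using eqpoll_iff_card[of P "Pow X"] P that by (metis finite_Pow_iff)
    with P(1) show ?thesis by (intro bexI[of _ P]) simp_all
  qed
  obtain P :: "'u set" where P: "finite P" "card P = 2"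
    using infinite_arbitrarily_large[OF assms] by metis
  obtain x y where "P = {x, y}" "x \<noteq> y"
    using P(2) unfolding card_2_iff by (elim exE conjE)
  with P have two: "\<exists>X\<in>{X :: 'u set. finite X}. \<exists>x\<in>X. \<exists>y\<in>X. x \<noteq> y"
    by (intro bexI[of _ P] bexI[of _ x] bexI[of _ y]) simp_all
  show ?thesis
    unfolding set_universe_def
  proof (intro conjI)
    show "\<exists>X\<in>{X :: 'u set. finite X}. \<exists>x\<in>X. \<exists>y\<in>X. x \<noteq> y" by (rule two)
    show "\<forall>X\<in>{X :: 'u set. finite X}. \<forall>Y. Y \<subseteq> X \<longrightarrow> Y \<in> {X. finite X}"
      by (auto intro: rev_finite_subset)
    show "\<forall>X\<in>{X :: 'u set. finite X}. \<forall>f. f ` X \<in> {X :: 'u set. finite X}" by simp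
    show "\<forall>X\<in>{X :: 'u set. finite X}. \<exists>P\<in>{X :: 'u set. finite X}. P \<approx> Pow X"
      using ex by simp
    show "\<forall>I\<in>{X :: 'u set. finite X}. \<forall>F. (\<forall>i\<in>I. F i \<in> {X :: 'u set. finite X}) \<longrightarrow>
        (\<Union>i\<in>I. F i) \<in> {X :: 'u set. finite X}" by simp
  qed
qed


section \<open>Constructs\<close>

text \<open>
  An object of a construct is a structured set \<open>(X, s)\<close>; a morphism is an extensional map between
  the underlying sets. Composition and identities are those of sets.
\<close>

record ('u, 's) construct =
  Obj :: "('u set \<times> 's) set"
  Hom :: "'u set \<times> 's \<Rightarrow> 'u set \<times> 's \<Rightarrow> ('u \<Rightarrow> 'u) set"

definition ident :: "'u set \<times> 's \<Rightarrow> 'u \<Rightarrow> 'u" where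
  "ident X = (\<lambda>x\<in>fst X. x)"

text \<open>\<open>composite X g f\<close> is the composite of \<open>f\<close>, which has domain \<open>X\<close>, followed by \<open>g\<close>.\<close>

definition composite :: "'u set \<times> 's \<Rightarrow> ('u \<Rightarrow> 'u) \<Rightarrow> ('u \<Rightarrow> 'u) \<Rightarrow> 'u \<Rightarrow> 'u" where
  "composite X g f = compose (fst X) g f"

definition is_construct :: "('u, 's) construct \<Rightarrow> bool" where
  "is_construct C \<longleftrightarrow>
     (\<forall>X Y. X \<notin> Obj C \<or> Y \<notin> Obj C \<longrightarrow> Hom C X Y = {}) \<and>
     (\<forall>X\<in>Obj C. \<forall>Y\<in>Obj C. Hom C X Y \<subseteq> fst X \<rightarrow>\<^sub>E fst Y) \<and>
     (\<forall>X\<in>Obj C. ident X \<in> Hom C X X) \<and>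
     (\<forall>X\<in>Obj C. \<forall>Y\<in>Obj C. \<forall>Z\<in>Obj C. \<forall>f\<in>Hom C X Y. \<forall>g\<in>Hom C Y Z. composite X g f \<in> Hom C X Z)"

definition subconstruct :: "('u, 's) construct \<Rightarrow> ('u, 's) construct \<Rightarrow> bool" where
  "subconstruct A B \<longleftrightarrow>
     is_construct A \<and> Obj A \<subseteq> Obj B \<and> (\<forall>X\<in>Obj A. \<forall>Y\<in>Obj A. Hom A X Y \<subseteq> Hom B X Y)"

definition full_on :: "('u, 's) construct \<Rightarrow> ('u set \<times> 's \<Rightarrow> bool) \<Rightarrow> ('u, 's) construct" where
  "full_on B P =
     \<lparr>Obj = {X \<in> Obj B. P X},
      Hom = (\<lambda>X Y. if X \<in> Obj B \<and> P X \<and> Y \<in> Obj B \<and> P Y then Hom B X Y else {})\<rparr>"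

definition is_reflection ::
  "('u, 's) construct \<Rightarrow> ('u, 's) construct \<Rightarrow> 'u set \<times> 's \<Rightarrow> ('u \<Rightarrow> 'u) \<Rightarrow> 'u set \<times> 's \<Rightarrow> bool" where
  "is_reflection A B X \<rho> R \<longleftrightarrow>
     R \<in> Obj A \<and> \<rho> \<in> Hom B X R \<and>
     (\<forall>Y\<in>Obj A. \<forall>f\<in>Hom B X Y. \<exists>!g. g \<in> Hom A R Y \<and> composite X g \<rho> = f)"

definition is_coreflection ::
  "('u, 's) construct \<Rightarrow> ('u, 's) construct \<Rightarrow> 'u set \<times> 's \<Rightarrow> ('u \<Rightarrow> 'u) \<Rightarrow> 'u set \<times> 's \<Rightarrow> bool" where
  "is_coreflection A B X \<kappa> K \<longleftrightarrow>
     K \<in> Obj A \<and> \<kappa> \<in> Hom B K X \<and>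
     (\<forall>Y\<in>Obj A. \<forall>f\<in>Hom B Y X. \<exists>!g. g \<in> Hom A Y K \<and> composite Y \<kappa> g = f)"

definition concretely_reflective :: "('u, 's) construct \<Rightarrow> ('u, 's) construct \<Rightarrow> bool" where
  "concretely_reflective A B \<longleftrightarrow>
     (\<forall>X\<in>Obj B. \<exists>R. fst R = fst X \<and> is_reflection A B X (ident X) R)"

definition concretely_coreflective :: "('u, 's) construct \<Rightarrow> ('u, 's) construct \<Rightarrow> bool" where
  "concretely_coreflective A B \<longleftrightarrow>
     (\<forall>X\<in>Obj B. \<exists>K. fst K = fst X \<and> is_coreflection A B X (ident X) K)"

definition stable_subconstruct :: "('u, 's) construct \<Rightarrow> ('u, 's) construct \<Rightarrow> bool" where
  "stable_subconstruct A B \<longleftrightarrow>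
     subconstruct A B \<and> concretely_reflective A B \<and> concretely_coreflective A B"


section \<open>Cartesian closedness\<close>

definition is_product ::
  "('u, 's) construct \<Rightarrow> 'i set \<Rightarrow> ('i \<Rightarrow> 'u set \<times> 's) \<Rightarrow>
   'u set \<times> 's \<Rightarrow> ('i \<Rightarrow> 'u \<Rightarrow> 'u) \<Rightarrow> bool" where
  "is_product C I F P \<pi> \<longleftrightarrow>
     P \<in> Obj C \<and> (\<forall>i\<in>I. \<pi> i \<in> Hom C P (F i)) \<and>
     (\<forall>Z\<in>Obj C. \<forall>h. (\<forall>i\<in>I. h i \<in> Hom C Z (F i)) \<longrightarrow>
        (\<exists>!m. m \<in> Hom C Z P \<and> (\<forall>i\<in>I. composite Z (\<pi> i) m = h i)))"

definition has_finite_products :: "('u, 's) construct \<Rightarrow> bool" where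
  "has_finite_products C \<longleftrightarrow>
     (\<forall>(I :: nat set) F. finite I \<and> (\<forall>i\<in>I. F i \<in> Obj C) \<longrightarrow> (\<exists>P \<pi>. is_product C I F P \<pi>))"

definition is_binary_product ::
  "('u, 's) construct \<Rightarrow> 'u set \<times> 's \<Rightarrow> 'u set \<times> 's \<Rightarrow>
   'u set \<times> 's \<Rightarrow> ('u \<Rightarrow> 'u) \<Rightarrow> ('u \<Rightarrow> 'u) \<Rightarrow> bool" where
  "is_binary_product C A B P p q \<longleftrightarrow>
     is_product C UNIV (\<lambda>b. if b then A else B) P (\<lambda>b. if b then p else q)"

text \<open>
  Morphisms do not record their domain and codomain, hence the first two arguments of \<open>on_mor\<close>.
\<close>

record ('u, 's) cfunctor =
  on_obj :: "'u set \<times> 's \<Rightarrow> 'u set \<times> 's"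
  on_mor :: "'u set \<times> 's \<Rightarrow> 'u set \<times> 's \<Rightarrow> ('u \<Rightarrow> 'u) \<Rightarrow> 'u \<Rightarrow> 'u"

definition is_functor ::
  "('u, 's) construct \<Rightarrow> ('u, 's) construct \<Rightarrow> ('u, 's) cfunctor \<Rightarrow> bool" where
  "is_functor C D F \<longleftrightarrow>
     (\<forall>X\<in>Obj C. on_obj F X \<in> Obj D) \<and>
     (\<forall>X\<in>Obj C. \<forall>Y\<in>Obj C. \<forall>f\<in>Hom C X Y.
        on_mor F X Y f \<in> Hom D (on_obj F X) (on_obj F Y)) \<and>
     (\<forall>X\<in>Obj C. on_mor F X X (ident X) = ident (on_obj F X)) \<and>
     (\<forall>X\<in>Obj C. \<forall>Y\<in>Obj C. \<forall>Z\<in>Obj C. \<forall>f\<in>Hom C X Y. \<forall>g\<in>Hom C Y Z.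
        on_mor F X Z (composite X g f) = composite (on_obj F X) (on_mor F Y Z g) (on_mor F X Y f))"

definition right_adjoint ::
  "('u, 's) construct \<Rightarrow> ('u, 's) construct \<Rightarrow> ('u, 's) cfunctor \<Rightarrow> ('u, 's) cfunctor \<Rightarrow> bool" where
  "right_adjoint C D F G \<longleftrightarrow>
     is_functor C D F \<and> is_functor D C G \<and>
     (\<exists>\<phi>.
        (\<forall>X\<in>Obj C. \<forall>Y\<in>Obj D.
           bij_betw (\<phi> X Y) (Hom D (on_obj F X) Y) (Hom C X (on_obj G Y))) \<and>
        (\<forall>X\<in>Obj C. \<forall>X'\<in>Obj C. \<forall>Y\<in>Obj D. \<forall>h\<in>Hom C X' X. \<forall>f\<in>Hom D (on_obj F X) Y.
           \<phi> X' Y (composite (on_obj F X') f (on_mor F X' X h)) = composite X' (\<phi> X Y f) h) \<and>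
        (\<forall>X\<in>Obj C. \<forall>Y\<in>Obj D. \<forall>Y'\<in>Obj D. \<forall>k\<in>Hom D Y Y'. \<forall>f\<in>Hom D (on_obj F X) Y.
           \<phi> X Y' (composite (on_obj F X) k f) = composite X (on_mor G Y Y' k) (\<phi> X Y f)))"

text \<open>
  \<open>F\<close> is the functor \<open>A \<times> -\<close> for some choice of binary products; any two choices give naturally
  isomorphic functors.
\<close>

definition is_product_functor ::
  "('u, 's) construct \<Rightarrow> 'u set \<times> 's \<Rightarrow> ('u, 's) cfunctor \<Rightarrow> bool" where
  "is_product_functor C A F \<longleftrightarrow>
     is_functor C C F \<and>
     (\<exists>p q.
        (\<forall>B\<in>Obj C. is_binary_product C A B (on_obj F B) (p B) (q B)) \<and>
        (\<forall>B\<in>Obj C. \<forall>B'\<in>Obj C. \<forall>f\<in>Hom C B B'.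
           composite (on_obj F B) (p B') (on_mor F B B' f) = p B \<and>
           composite (on_obj F B) (q B') (on_mor F B B' f) = composite (on_obj F B) f (q B)))"

definition cartesian_closed :: "('u, 's) construct \<Rightarrow> bool" where
  "cartesian_closed C \<longleftrightarrow>
     has_finite_products C \<and>
     (\<forall>A\<in>Obj C. \<exists>F. is_product_functor C A F \<and> (\<exists>G. right_adjoint C C F G))"


section \<open>Categories enriched over the unit interval\<close>

definition continuous_t_norm :: "(real \<Rightarrow> real \<Rightarrow> real) \<Rightarrow> bool" where
  "continuous_t_norm t \<longleftrightarrow>
     (\<forall>a\<in>{0..1}. \<forall>b\<in>{0..1}. t a b \<in> {0..1}) \<and>
     continuous_on ({0..1} \<times> {0..1}) (\<lambda>(a, b). t a b) \<and>
     (\<forall>a\<in>{0..1}. \<forall>b\<in>{0..1}. t a b = t b a) \<and>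
     (\<forall>a\<in>{0..1}. \<forall>b\<in>{0..1}. \<forall>c\<in>{0..1}. t (t a b) c = t a (t b c)) \<and>
     (\<forall>a\<in>{0..1}. \<forall>a'\<in>{0..1}. \<forall>b\<in>{0..1}. \<forall>b'\<in>{0..1}. a \<le> a' \<and> b \<le> b' \<longrightarrow> t a b \<le> t a' b') \<and>
     (\<forall>a\<in>{0..1}. t a 1 = a \<and> t 1 a = a)"

definition idempotent :: "(real \<Rightarrow> real \<Rightarrow> real) \<Rightarrow> real \<Rightarrow> bool" where
  "idempotent t p \<longleftrightarrow> t p p = p"

definition M :: "(real \<Rightarrow> real \<Rightarrow> real) \<Rightarrow> real set" where
  "M t = {a \<in> {0..1}. idempotent t (t a a)}"

definition is_unit_category ::
  "(real \<Rightarrow> real \<Rightarrow> real) \<Rightarrow> 'u set \<times> ('u \<times> 'u \<Rightarrow> real) \<Rightarrow> bool" where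
  "is_unit_category t = (\<lambda>(X, r).
     r \<in> X \<times> X \<rightarrow>\<^sub>E {0..1} \<and>
     (\<forall>x\<in>X. r (x, x) = 1) \<and>
     (\<forall>x\<in>X. \<forall>y\<in>X. \<forall>z\<in>X. t (r (y, z)) (r (x, y)) \<le> r (x, z)))"

definition unit_functors ::
  "'u set \<times> ('u \<times> 'u \<Rightarrow> real) \<Rightarrow> 'u set \<times> ('u \<times> 'u \<Rightarrow> real) \<Rightarrow> ('u \<Rightarrow> 'u) set" where
  "unit_functors = (\<lambda>(X, r) (Y, s).
     {f \<in> X \<rightarrow>\<^sub>E Y. \<forall>x\<in>X. \<forall>x'\<in>X. r (x, x') \<le> s (f x, f x')})"

definition unit_Cat ::
  "'u set set \<Rightarrow> (real \<Rightarrow> real \<Rightarrow> real) \<Rightarrow> ('u, 'u \<times> 'u \<Rightarrow> real) construct" where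
  "unit_Cat U t =
     \<lparr>Obj = {X. fst X \<in> U \<and> is_unit_category t X},
      Hom = (\<lambda>X Y. if fst X \<in> U \<and> is_unit_category t X \<and> fst Y \<in> U \<and> is_unit_category t Y
                   then unit_functors X Y else {})\<rparr>"

text \<open>
  The join and the meet in the unit interval of a set \<open>T\<close> of its elements are
  \<open>Sup (insert 0 T)\<close> and \<open>Inf (insert 1 T)\<close>: this differs from \<open>Sup T\<close> and \<open>Inf T\<close>, which are
  taken in the reals, only for empty \<open>T\<close>.
\<close>

definition suitable :: "(real \<Rightarrow> real \<Rightarrow> real) \<Rightarrow> (real \<times> real) set \<Rightarrow> bool" where
  "suitable t S \<longleftrightarrow>
     S \<subseteq> {0..1} \<times> {0..1} \<and>
     (\<forall>T\<subseteq>S. (Sup (insert 0 (fst ` T)), Sup (insert 0 (snd ` T))) \<in> S) \<and>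
     (\<forall>T\<subseteq>S. (Inf (insert 1 (fst ` T)), Inf (insert 1 (snd ` T))) \<in> S) \<and>
     (\<forall>a b. (a, b) \<in> S \<longrightarrow> (b, a) \<in> S) \<and>
     (\<forall>a1 b1 a2 b2. (a1, b1) \<in> S \<and> (a2, b2) \<in> S \<longrightarrow> (t a1 a2, t b1 b2) \<in> S)"

definition unit_Cat_S ::
  "'u set set \<Rightarrow> (real \<Rightarrow> real \<Rightarrow> real) \<Rightarrow> (real \<times> real) set \<Rightarrow>
   ('u, 'u \<times> 'u \<Rightarrow> real) construct" where
  "unit_Cat_S U t S =
     full_on (unit_Cat U t) (\<lambda>(X, r). \<forall>x\<in>X. \<forall>y\<in>X. (r (x, y), r (y, x)) \<in> S)"

definition M_Cat ::
  "'u set set \<Rightarrow> (real \<Rightarrow> real \<Rightarrow> real) \<Rightarrow> ('u, 'u \<times> 'u \<Rightarrow> real) construct" where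
  "M_Cat U t = full_on (unit_Cat U t) (\<lambda>(X, r). \<forall>x\<in>X. \<forall>y\<in>X. r (x, y) \<in> M t)"

end

theory Submission
  imports Defs "HOL-Analysis.Elementary_Metric_Spaces"
begin

text \<open>
  Objects are regarded as sets with an asymmetric distance \<open>r (x, y)\<close> in the unit interval, where
  larger values mean closer points and distances compose by the t-norm.

  A stable subconstruct is determined by the two-point spaces in it. Reflectivity makes it full and
  closed under subspaces, so the pairs of opposite distances in its objects are the pairs whose
  two-point space it contains; coreflectivity makes it closed under final structures, and every space
  is final with respect to its two-point subspaces. The same two closure properties, applied to
  two-point spaces and to a three-point space with two composable steps, show that the set \<open>S\<close> of
  these pairs is suitable (\<open>stable.ex_suitable\<close>). Conversely, suitability is what is needed for
  reflections (meets of larger metrics) and coreflections (largest pairs in \<open>S\<close> below given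
  distances) to exist (\<open>suitable_enrichment.stable_C\<close>).

  It remains to see when the construct given by \<open>S\<close> is cartesian closed. Products carry the minimum
  of the distances, while paths compose by the t-norm; closedness means that products preserve the
  gluing of paths, and this is a compatibility of the minimum with the t-norm. Testing it on the path
  with two steps of length \<open>a\<close> and a space with two points at distance \<open>c = t a a\<close> gives \<open>c \<le> t c a\<close>,
  so that \<open>t a a\<close> is idempotent (\<open>suitable_enrichment.cartesian_closed_imp_in_M\<close>). For the
  converse, two elements \<open>a \<le> b\<close> of \<open>M t\<close> either are separated by an idempotent or have an idempotent
  product, because the outer terms of \<open>t a a \<le> t a b \<le> t b b\<close> are idempotent; and an idempotent is a
  unit for everything below it. From this follows the inequality \<open>t_norm.M_min_product_le\<close>, which
  yields the triangle inequality for the largest distance between morphisms that keeps evaluation a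
  morphism
  (\<open>closed_enrichment.power\<close>). Currying then is the required adjunction. Finally \<open>M t \<times> M t\<close> is
  itself suitable, so it gives the largest of these constructs.
\<close>


section \<open>Continuous t-norms and the set of elements with idempotent square\<close>

locale t_norm =
  fixes t :: "real \<Rightarrow> real \<Rightarrow> real"
  assumes continuous_t_norm: "continuous_t_norm t"
begin

lemma t_in: "a \<in> {0..1} \<Longrightarrow> b \<in> {0..1} \<Longrightarrow> t a b \<in> {0..1}"
  and t_comm: "a \<in> {0..1} \<Longrightarrow> b \<in> {0..1} \<Longrightarrow> t a b = t b a"
  and t_assoc: "a \<in> {0..1} \<Longrightarrow> b \<in> {0..1} \<Longrightarrow> c \<in> {0..1} \<Longrightarrow> t (t a b) c = t a (t b c)"
  and t_one_right: "a \<in> {0..1} \<Longrightarrow> t a 1 = a"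
  and t_one_left: "a \<in> {0..1} \<Longrightarrow> t 1 a = a"
  and t_cont: "continuous_on ({0..1} \<times> {0..1}) (\<lambda>(a, b). t a b)"
  using continuous_t_norm unfolding continuous_t_norm_def by blast+

lemma t_mono:
  "a \<le> a' \<Longrightarrow> b \<le> b' \<Longrightarrow> a \<in> {0..1} \<Longrightarrow> a' \<in> {0..1} \<Longrightarrow> b \<in> {0..1} \<Longrightarrow> b' \<in> {0..1}
    \<Longrightarrow> t a b \<le> t a' b'"
  using continuous_t_norm unfolding continuous_t_norm_def by blast

lemma t_le_left: "a \<in> {0..1} \<Longrightarrow> b \<in> {0..1} \<Longrightarrow> t a b \<le> a"
  using t_mono[of a a b 1] t_one_right[of a] by simp

lemma t_le_right: "a \<in> {0..1} \<Longrightarrow> b \<in> {0..1} \<Longrightarrow> t a b \<le> b"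
  using t_le_left[of b a] t_comm[of a b] by simp

lemma t_interchange:
  assumes "a \<in> {0..1}" "b \<in> {0..1}" "c \<in> {0..1}" "d \<in> {0..1}"
  shows "t (t a b) (t c d) = t (t a c) (t b d)"
proof -
  have "t (t a b) (t c d) = t a (t (t b c) d)"
    using assms by (simp add: t_assoc t_in del: atLeastAtMost_iff)
  also have "\<dots> = t a (t (t c b) d)"
    using assms by (simp add: t_comm del: atLeastAtMost_iff)
  also have "\<dots> = t (t a c) (t b d)"
    using assms by (simp add: t_assoc t_in del: atLeastAtMost_iff)
  finally show ?thesis .
qed

text \<open>
  This is the only consequence of continuity beyond the closedness of \<open>M t\<close>: by the intermediate
  value theorem, every \<open>w \<le> e\<close> is of the form \<open>t e z\<close>, and multiplying by \<open>e\<close> once more changes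
  nothing.
\<close>

lemma idempotent_absorbs:
  assumes e: "e \<in> {0..1}" "idempotent t e" and w: "w \<in> {0..1}" "w \<le> e"
  shows "t e w = w" "t w e = w"
proof -
  have "continuous_on {0..1} (\<lambda>z. (\<lambda>(a, b). t a b) (e, z))"
    by (rule continuous_on_compose2[OF t_cont]) (use e in \<open>auto intro!: continuous_intros\<close>)
  then have "continuous_on {0..1} (t e)" by simp
  moreover have "t e 0 \<le> w" "w \<le> t e 1"
    using t_le_right[of e 0] e w t_one_right[of e] by auto
  ultimately obtain z where z: "0 \<le> z" "z \<le> 1" "t e z = w"
    using IVT'[of "t e" 0 w 1] by auto
  have "t e w = t (t e e) z"
    using z e t_assoc[of e e z] by simp
  then show "t e w = w"
    using e(2) z(3) by (simp add: idempotent_def)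
  then show "t w e = w"
    using t_comm e w by simp
qed

text \<open>
  For \<open>a \<le> b\<close> the squares satisfy \<open>t a a \<le> t a b \<le> t b b\<close>. If \<open>a \<le> t b b\<close>, then the idempotent
  \<open>t b b\<close> separates \<open>a\<close> from \<open>b\<close>; otherwise \<open>t b b\<close>, being its own square, is at most \<open>t a a\<close>,
  and all three products coincide.
\<close>

lemma M_separated_or_idempotent_product:
  assumes a: "a \<in> M t" and b: "b \<in> M t" and le: "a \<le> b"
  shows "idempotent t (t a b) \<or> (\<exists>e\<in>{0..1}. idempotent t e \<and> a \<le> e \<and> e \<le> b)"
proof (cases "a \<le> t b b")
  case True
  then show ?thesis
    using b t_le_left[of b b] t_in[of b b] unfolding M_def by blast
next
  case False
  have I: "a \<in> {0..1}" "b \<in> {0..1}" using a b by (auto simp: M_def)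
  have "t (t b b) (t b b) \<le> t a a"
    using False I t_in[of b b] by (intro t_mono) auto
  then have "t b b \<le> t a a"
    using b by (simp add: M_def idempotent_def)
  moreover have "t a a \<le> t a b" "t a b \<le> t b b"
    using le I by (auto intro!: t_mono)
  ultimately have "t a b = t a a" by simp
  then show ?thesis using a by (simp add: M_def)
qed

text \<open>
  Below a product of two elements of \<open>M t\<close>, the larger factor acts as a unit: it lies above an
  idempotent above the product, namely the product itself or one that separates the two factors.
\<close>

lemma M_unit_below_product:
  assumes a: "a \<in> M t" and b: "b \<in> M t" and w: "w \<in> {0..1}" "w \<le> t a b"
  shows "t w a = w \<or> t w b = w"
proof -
  have *: "t w b = w" if a: "a \<in> M t" and b: "b \<in> M t" and le: "a \<le> b"
    and w: "w \<in> {0..1}" "w \<le> t a b" for a b w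
  proof -
    have I: "a \<in> {0..1}" "b \<in> {0..1}" using a b by (auto simp: M_def)
    have "\<exists>e\<in>{0..1}. idempotent t e \<and> t a b \<le> e \<and> e \<le> b"
      using M_separated_or_idempotent_product[OF a b le] t_in[OF I] t_le_left[OF I] t_le_right[OF I]
      by (meson order_refl order_trans)
    then obtain e where e: "e \<in> {0..1}" "idempotent t e" "t a b \<le> e" "e \<le> b" by blast
    have "t w e = w"
      using idempotent_absorbs(2)[of e w] e w by simp
    then show ?thesis
      using t_mono[of w w e b] t_le_left[of w b] e I w by auto
  qed
  have I: "a \<in> {0..1}" "b \<in> {0..1}" using a b by (auto simp: M_def)
  show ?thesis
    using *[OF a b] *[OF b a] w t_comm[OF I] by (metis linear)
qed

text \<open>
  The inequality behind the triangle inequality of function spaces: \<open>a\<close> and \<open>b\<close> stand for the two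
  consecutive distances between functions, \<open>w\<close> for a distance in the domain. If \<open>w\<close> is below the
  product, then one factor is a unit for it; if \<open>w\<close> is above a factor, then the minimum with that
  factor cuts nothing off. In the remaining case \<open>w\<close> lies strictly between the product and both
  factors. Then no idempotent separates \<open>a\<close> from \<open>b\<close>, as it would be a unit for \<open>w\<close>, so their product
  is an idempotent below both \<open>w\<close> and \<open>b\<close>.
\<close>

lemma M_min_product_le:
  assumes a: "a \<in> M t" and b: "b \<in> M t" and w: "w \<in> M t"
  shows "min (t a b) w \<le> t (min a w) b \<or> min (t a b) w \<le> t a (min b w)"
proof -
  have I: "a \<in> {0..1}" "b \<in> {0..1}" "w \<in> {0..1}" using a b w by (auto simp: M_def)
  consider "w \<le> t a b" | "a \<le> w \<or> b \<le> w" | "t a b < w" "w < a" "w < b" by linarith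
  then show ?thesis
  proof cases
    case 1
    then have "min a w = w" "min b w = w"
      using t_le_left[OF I(1,2)] t_le_right[OF I(1,2)] by auto
    then show ?thesis
      using M_unit_below_product[OF a b I(3) 1] t_comm[OF I(1,3)] 1 by auto
  next
    case 2
    then show ?thesis by (auto simp: min_def)
  next
    case 3
    have sep: "\<not> (\<exists>e\<in>{0..1}. idempotent t e \<and> min a b \<le> e \<and> e \<le> max a b)"
    proof
      assume "\<exists>e\<in>{0..1}. idempotent t e \<and> min a b \<le> e \<and> e \<le> max a b"
      then obtain e where e: "e \<in> {0..1}" "idempotent t e" "min a b \<le> e" "e \<le> max a b" by blast
      have "t e w = w"
        using idempotent_absorbs(1)[OF e(1,2) I(3)] e(3) 3 by auto
      moreover have "t e w \<le> t (max a b) (min a b)"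
        using e I 3 by (intro t_mono) auto
      moreover have "t (max a b) (min a b) = t a b"
        using t_comm[OF I(1,2)] by (simp add: max_def min_def)
      ultimately show False using 3 by simp
    qed
    have idem: "idempotent t (t a b)"
    proof (cases "a \<le> b")
      case True
      then show ?thesis
        using M_separated_or_idempotent_product[OF a b] sep by (auto simp: min_def max_def)
    next
      case False
      then show ?thesis
        using M_separated_or_idempotent_product[OF b a] sep t_comm[OF I(1,2)]
        by (auto simp: min_def max_def)
    qed
    have "t (t a b) (t a b) \<le> t w b"
      using 3 I t_in[OF I(1,2)] t_le_right[OF I(1,2)] by (intro t_mono) auto
    then show ?thesis
      using idem 3 by (simp add: idempotent_def min_def)
  qed
qed

lemma M_t_closed:
  assumes a: "a \<in> M t" and b: "b \<in> M t"
  shows "t a b \<in> M t"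
proof -
  have I: "a \<in> {0..1}" "b \<in> {0..1}" using a b by (auto simp: M_def)
  have sq: "t (t a b) (t a b) = t (t a a) (t b b)"
    using t_interchange[OF I I] .
  have "t (t (t a a) (t b b)) (t (t a a) (t b b)) = t (t (t a a) (t a a)) (t (t b b) (t b b))"
    using I t_in by (intro t_interchange) auto
  also have "\<dots> = t (t a a) (t b b)"
    using a b by (simp add: M_def idempotent_def)
  finally show ?thesis
    using t_in[OF I] sq by (simp add: M_def idempotent_def)
qed

lemma zero_in_M: "0 \<in> M t"
  using t_le_left[of 0 0] t_in[of 0 0] by (auto simp: M_def idempotent_def)

lemma one_in_M: "1 \<in> M t"
  using t_one_left[of 1] by (simp add: M_def idempotent_def)

lemma closed_M: "closed (M t)"
proof -
  have sq: "continuous_on {0..1} (\<lambda>a. t (f a) (f a))"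
    if f: "continuous_on {0..1} f" "f ` {0..1} \<subseteq> {0..1}" for f
  proof -
    have "continuous_on {0..1} (\<lambda>a. (\<lambda>(a, b). t a b) (f a, f a))"
      by (rule continuous_on_compose2[OF t_cont]) (use f in \<open>auto intro!: continuous_intros\<close>)
    then show ?thesis by simp
  qed
  let ?d = "\<lambda>a. t (t a a) (t a a) - t a a"
  have "continuous_on {0..1} (\<lambda>a. t a a)"
    using sq[of id] by (simp add: id_def)
  moreover have "continuous_on {0..1} (\<lambda>a. t (t a a) (t a a))"
    by (rule sq) (use calculation t_in in auto)
  ultimately have "continuous_on {0..1} ?d"
    by (intro continuous_intros)
  then have "closed (?d -` {0} \<inter> {0..1})"
    by (intro closed_vimage_Int) auto
  moreover have "?d -` {0} \<inter> {0..1} = M t"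
    by (auto simp: M_def idempotent_def)
  ultimately show ?thesis by simp
qed

end

section \<open>Sets that embed into the universe\<close>

text \<open>
  Carriers of products and function spaces are naturally sets of functions; they become members of
  the universe along an injection.
\<close>

definition small :: "'u set set \<Rightarrow> 'x set \<Rightarrow> bool" where
  "small U Q \<longleftrightarrow> (\<exists>P\<in>U. Q \<lesssim> P)"

locale universe =
  fixes U :: "'u set set"
  assumes set_universe: "set_universe U"
begin

lemma subset_in_U: "X \<in> U \<Longrightarrow> Y \<subseteq> X \<Longrightarrow> Y \<in> U"
  and image_in_U: "X \<in> U \<Longrightarrow> f ` X \<in> U"
  and Pow_eqpoll_in_U: "X \<in> U \<Longrightarrow> \<exists>P\<in>U. P \<approx> Pow X"
  and UN_in_U: "I \<in> U \<Longrightarrow> (\<And>i. i \<in> I \<Longrightarrow> F i \<in> U) \<Longrightarrow> (\<Union>i\<in>I. F i) \<in> U"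
  using set_universe unfolding set_universe_def by blast+

lemma two_points_in_U: obtains x y :: 'u where "{x, y} \<in> U" "x \<noteq> y"
proof -
  obtain X x y where X: "X \<in> U" "x \<in> X" "y \<in> X" "x \<noteq> y"
    using set_universe unfolding set_universe_def by metis
  then show ?thesis using subset_in_U[of X "{x, y}"] that by simp
qed

lemma smallE:
  assumes "small U Q"
  obtains g :: "'x \<Rightarrow> 'u" where "inj_on g Q" "g ` Q \<in> U"
proof -
  obtain P and g :: "'x \<Rightarrow> 'u" where "P \<in> U" "inj_on g Q" "g ` Q \<subseteq> P"
    using assms unfolding small_def lepoll_def by blast
  then show ?thesis using that subset_in_U by blast
qed

lemma small_member: "X \<in> U \<Longrightarrow> small U X"
  unfolding small_def using lepoll_refl by blast

lemma small_lepoll: "small U Q \<Longrightarrow> R \<lesssim> Q \<Longrightarrow> small U R"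
  unfolding small_def using lepoll_trans by blast

lemma small_subset: "small U Q \<Longrightarrow> R \<subseteq> Q \<Longrightarrow> small U R"
  by (rule small_lepoll[OF _ subset_imp_lepoll])

lemma small_Pow:
  assumes "small U Q" shows "small U (Pow Q)"
proof -
  obtain g :: "'a \<Rightarrow> 'u" where g: "inj_on g Q" "g ` Q \<in> U" using assms by (rule smallE)
  obtain P where P: "P \<in> U" "P \<approx> Pow (g ` Q)" using Pow_eqpoll_in_U[OF g(2)] by blast
  have "inj_on (image g) (Pow Q)"
    by (rule inj_on_image_Pow[OF g(1)])
  then have "Pow Q \<lesssim> Pow (g ` Q)"
    unfolding lepoll_def by (intro exI[of _ "image g"]) auto
  also have "Pow (g ` Q) \<lesssim> P"
    using P(2) eqpoll_imp_lepoll eqpoll_sym by blast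
  finally show ?thesis using P(1) unfolding small_def by blast
qed

lemma small_finite:
  assumes "finite Q" shows "small U Q"
proof -
  have big: "\<exists>P\<in>U. n \<le> card P \<and> finite P" for n
  proof (induction n)
    case 0
    then show ?case using two_points_in_U by (metis finite.emptyI finite.insertI zero_le)
  next
    case (Suc n)
    then obtain P where P: "P \<in> U" "n \<le> card P" "finite P" by blast
    obtain P' where P': "P' \<in> U" "P' \<approx> Pow P" using Pow_eqpoll_in_U[OF P(1)] by blast
    have "card P' = 2 ^ card P" "finite P'"
      using P' P(3) eqpoll_iff_card eqpoll_finite_iff
      by (metis card_Pow finite_Pow_iff)+
    moreover have "Suc n \<le> 2 ^ card P"
      using P(2) less_exp[of "card P"] by linarith
    ultimately show ?case using P'(1) by (intro bexI[of _ P']) auto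
  qed
  obtain P where "P \<in> U" "card Q \<le> card P" "finite P" using big by blast
  then show ?thesis
    unfolding small_def lepoll_def using card_le_inj[OF assms] by metis
qed

lemma union_in_U:
  assumes "X \<in> U" "Y \<in> U" shows "X \<union> Y \<in> U"
proof -
  obtain x y :: 'u where xy: "{x, y} \<in> U" "x \<noteq> y" by (rule two_points_in_U)
  have "(\<Union>i\<in>{x, y}. if i = x then X else Y) \<in> U"
    by (rule UN_in_U[OF xy(1)]) (use assms in auto)
  then show ?thesis using xy(2) by (simp add: Un_commute)
qed

lemma finite_UN_in_U:
  assumes "finite I" "I \<noteq> {}" "\<And>i. i \<in> I \<Longrightarrow> F i \<in> U"
  shows "(\<Union>i\<in>I. F i) \<in> U"
  using assms by (induction rule: finite_ne_induct) (auto intro: union_in_U)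

lemma small_Times:
  assumes "small U Q" "small U R" shows "small U (Q \<times> R)"
proof -
  obtain g :: "'a \<Rightarrow> 'u" where g: "inj_on g Q" "g ` Q \<in> U" using assms(1) by (rule smallE)
  obtain h :: "'b \<Rightarrow> 'u" where h: "inj_on h R" "h ` R \<in> U" using assms(2) by (rule smallE)
  let ?kur = "\<lambda>(q, r). {{g q}, {g q, h r}}"
  have "inj_on ?kur (Q \<times> R)"
  proof (rule inj_onI, clarify)
    fix q r q' r' assume qr: "q \<in> Q" "r \<in> R" "q' \<in> Q" "r' \<in> R"
      and eq: "{{g q}, {g q, h r}} = {{g q'}, {g q', h r'}}"
    have "a = c \<and> b = d" if "{{a}, {a, b}} = {{c}, {c, d}}" for a b c d :: 'u
      using that unfolding doubleton_eq_iff by auto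
    from this[OF eq] show "q = q' \<and> r = r'"
      using g(1) h(1) qr by (simp add: inj_on_eq_iff)
  qed
  moreover have "?kur ` (Q \<times> R) \<subseteq> Pow (Pow (g ` Q \<union> h ` R))" by auto
  ultimately have "Q \<times> R \<lesssim> Pow (Pow (g ` Q \<union> h ` R))" unfolding lepoll_def by blast
  then show ?thesis
    by (rule small_lepoll[OF small_Pow[OF small_Pow[OF small_member[OF union_in_U[OF g(2) h(2)]]]]])
qed

lemma small_PiE:
  assumes I: "small U I" and W: "small U W" and F: "\<And>i. i \<in> I \<Longrightarrow> F i \<subseteq> W"
  shows "small U (Pi\<^sub>E I F)"
proof (rule small_lepoll[OF small_Pow[OF small_Times[OF I W]]])
  have "inj_on (\<lambda>f. (\<lambda>i. (i, f i)) ` I) (Pi\<^sub>E I F)"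
  proof (rule inj_onI)
    fix f f' assume f: "f \<in> Pi\<^sub>E I F" "f' \<in> Pi\<^sub>E I F"
      and eq: "(\<lambda>i. (i, f i)) ` I = (\<lambda>i. (i, f' i)) ` I"
    show "f = f'"
    proof (rule PiE_ext[OF f])
      fix i assume "i \<in> I"
      then have "(i, f i) \<in> (\<lambda>i. (i, f' i)) ` I" using eq by blast
      then show "f i = f' i" by blast
    qed
  qed
  moreover have "(\<lambda>f. (\<lambda>i. (i, f i)) ` I) ` Pi\<^sub>E I F \<subseteq> Pow (I \<times> W)"
    using F by (auto simp: PiE_def Pi_def)
  ultimately show "Pi\<^sub>E I F \<lesssim> Pow (I \<times> W)" unfolding lepoll_def by blast
qed

end


section \<open>Categories with pairs of opposite distances in a prescribed set\<close>

text \<open>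
  The metric lives on a set \<open>Q\<close> of any type, so that products and function spaces can be metrized
  before their points are renamed into the universe.
\<close>

definition S_metric ::
  "(real \<Rightarrow> real \<Rightarrow> real) \<Rightarrow> (real \<times> real) set \<Rightarrow> 'x set \<Rightarrow> ('x \<Rightarrow> 'x \<Rightarrow> real) \<Rightarrow> bool" where
  "S_metric t S Q d \<longleftrightarrow>
     (\<forall>x\<in>Q. d x x = 1) \<and>
     (\<forall>x\<in>Q. \<forall>y\<in>Q. d x y \<in> {0..1} \<and> (d x y, d y x) \<in> S) \<and>
     (\<forall>x\<in>Q. \<forall>y\<in>Q. \<forall>z\<in>Q. t (d y z) (d x y) \<le> d x z)"

lemma Obj_unit_Cat_S:
  "(X, r) \<in> Obj (unit_Cat_S U t S) \<longleftrightarrow>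
     X \<in> U \<and> r \<in> extensional (X \<times> X) \<and> S_metric t S X (curry r)"
  unfolding unit_Cat_S_def full_on_def unit_Cat_def is_unit_category_def S_metric_def
  by (auto simp: PiE_def Pi_def)

lemma Hom_unit_Cat_S:
  "Hom (unit_Cat_S U t S) X Y =
     (if X \<in> Obj (unit_Cat_S U t S) \<and> Y \<in> Obj (unit_Cat_S U t S) then unit_functors X Y else {})"
  unfolding unit_Cat_S_def full_on_def unit_Cat_def by auto

text \<open>Results about \<open>unit_Cat_S\<close> thus apply to the ambient construct.\<close>

lemma unit_Cat_S_full:
  assumes "{0..1} \<times> {0..1} \<subseteq> S"
  shows "unit_Cat_S U t S = unit_Cat U t"
proof -
  let ?P = "\<lambda>(X :: 'u set, r). \<forall>x\<in>X. \<forall>y\<in>X. (r (x, y), r (y, x)) \<in> S"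
  have P: "?P X" if "is_unit_category t X" for X :: "'u set \<times> ('u \<times> 'u \<Rightarrow> real)"
    using that assms by (fastforce simp: is_unit_category_def PiE_def Pi_def)
  have obj: "X \<in> Obj (unit_Cat U t) \<and> ?P X \<longleftrightarrow> fst X \<in> U \<and> is_unit_category t X" for X
    using P[of X] unfolding unit_Cat_def by auto
  have "{X \<in> Obj (unit_Cat U t). ?P X} = {X. fst X \<in> U \<and> is_unit_category t X}"
    by (simp only: obj)
  moreover have "(\<lambda>X Y. if X \<in> Obj (unit_Cat U t) \<and> ?P X \<and> Y \<in> Obj (unit_Cat U t) \<and> ?P Y
      then Hom (unit_Cat U t) X Y else {}) = Hom (unit_Cat U t)"
    by (intro ext) (use P in \<open>auto simp: unit_Cat_def\<close>)
  ultimately show ?thesis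
    unfolding unit_Cat_S_def full_on_def by (simp add: unit_Cat_def)
qed

text \<open>The category carried by \<open>Q\<close>, with its points renamed along an injection \<open>g\<close>.\<close>

definition transport :: "('x \<Rightarrow> 'u) \<Rightarrow> 'x set \<Rightarrow> ('x \<Rightarrow> 'x \<Rightarrow> real) \<Rightarrow> 'u set \<times> ('u \<times> 'u \<Rightarrow> real)" where
  "transport g Q d =
     (g ` Q, \<lambda>(u, v)\<in>g ` Q \<times> g ` Q. d (inv_into Q g u) (inv_into Q g v))"

lemma fst_transport [simp]: "fst (transport g Q d) = g ` Q"
  by (simp add: transport_def)

lemma snd_transport:
  "inj_on g Q \<Longrightarrow> x \<in> Q \<Longrightarrow> y \<in> Q \<Longrightarrow> snd (transport g Q d) (g x, g y) = d x y"
  by (simp add: transport_def)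

lemma transport_Obj:
  assumes g: "inj_on g Q" "g ` Q \<in> U" and d: "S_metric t S Q d"
  shows "transport g Q d \<in> Obj (unit_Cat_S U t S)"
  unfolding transport_def Obj_unit_Cat_S
  using assms by (auto simp: S_metric_def)

lemma unit_functors_iff:
  "f \<in> unit_functors X Y \<longleftrightarrow>
     f \<in> fst X \<rightarrow>\<^sub>E fst Y \<and> (\<forall>x\<in>fst X. \<forall>x'\<in>fst X. snd X (x, x') \<le> snd Y (f x, f x'))"
  by (cases X, cases Y) (simp add: unit_functors_def)

lemma unit_functors_from_transport:
  assumes "inj_on g Q"
  shows "f \<in> unit_functors (transport g Q d) Y \<longleftrightarrow>
     f \<in> g ` Q \<rightarrow>\<^sub>E fst Y \<and> (\<forall>x\<in>Q. \<forall>x'\<in>Q. d x x' \<le> snd Y (f (g x), f (g x')))"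
  using assms by (simp add: unit_functors_iff snd_transport)

lemma unit_functors_composite:
  assumes f: "f \<in> unit_functors X Y" and g: "g \<in> unit_functors Y Z"
  shows "composite X g f \<in> unit_functors X Z"
proof -
  have "snd X (x, x') \<le> snd Z (g (f x), g (f x'))" if "x \<in> fst X" "x' \<in> fst X" for x x'
  proof -
    have "f x \<in> fst Y" "f x' \<in> fst Y" "snd X (x, x') \<le> snd Y (f x, f x')"
      using f that by (auto simp: unit_functors_iff)
    then show ?thesis
      using g by (auto simp: unit_functors_iff intro: order_trans)
  qed
  then show ?thesis
    using f g by (auto simp: unit_functors_iff composite_def compose_def)
qed

lemma is_construct_unit_Cat_S: "is_construct (unit_Cat_S U t S)"
  unfolding is_construct_def
proof (intro conjI ballI)
  let ?C = "unit_Cat_S U t S"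
  show "\<forall>X Y. X \<notin> Obj ?C \<or> Y \<notin> Obj ?C \<longrightarrow> Hom ?C X Y = {}"
    by (simp add: Hom_unit_Cat_S)
  fix X assume X: "X \<in> Obj ?C"
  then show "ident X \<in> Hom ?C X X"
    by (auto simp: Hom_unit_Cat_S unit_functors_iff ident_def)
  fix Y assume Y: "Y \<in> Obj ?C"
  with X show "Hom ?C X Y \<subseteq> fst X \<rightarrow>\<^sub>E fst Y"
    by (auto simp: Hom_unit_Cat_S unit_functors_iff)
  fix Z f g assume "Z \<in> Obj ?C" "f \<in> Hom ?C X Y" "g \<in> Hom ?C Y Z"
  with X Y show "composite X g f \<in> Hom ?C X Z"
    by (auto simp: Hom_unit_Cat_S intro: unit_functors_composite)
qed

section \<open>Spaces with two and with three points\<close>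

context t_norm
begin

lemma t_le_leftI: "a \<le> c \<Longrightarrow> a \<in> {0..1} \<Longrightarrow> b \<in> {0..1} \<Longrightarrow> t a b \<le> c"
  using t_le_left[of a b] by linarith

lemma t_le_rightI: "b \<le> c \<Longrightarrow> a \<in> {0..1} \<Longrightarrow> b \<in> {0..1} \<Longrightarrow> t a b \<le> c"
  using t_le_right[of a b] by linarith

end

definition two_point :: "real \<Rightarrow> real \<Rightarrow> bool \<Rightarrow> bool \<Rightarrow> real" where
  "two_point a b x y = (if x = y then 1 else if y then a else b)"

text \<open>
  Two steps, from \<open>0\<close> to \<open>1\<close> and from \<open>1\<close> to \<open>2\<close>, and their composite. The components of \<open>p\<close> and
  \<open>q\<close> are the distances forth and back.
\<close>

definition three_point :: "(real \<Rightarrow> real \<Rightarrow> real) \<Rightarrow> real \<times> real \<Rightarrow> real \<times> real \<Rightarrow> nat \<Rightarrow> nat \<Rightarrow> real" where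
  "three_point t p q x y =
     (if x = y then 1
      else if x = 0 \<and> y = 1 then fst p else if x = 1 \<and> y = 0 then snd p
      else if x = 1 \<and> y = 2 then fst q else if x = 2 \<and> y = 1 then snd q
      else if x = 0 then t (fst p) (fst q) else t (snd p) (snd q))"

lemma ball_less_3: "(\<forall>x\<in>{..<3::nat}. P x) \<longleftrightarrow> P 0 \<and> P 1 \<and> P 2"
  by (auto simp: numeral_eq_Suc less_Suc_eq)

context t_norm
begin

lemma S_metric_two_point:
  assumes "S \<subseteq> {0..1} \<times> {0..1}" "(1, 1) \<in> S" "(a, b) \<in> S" "(b, a) \<in> S"
  shows "S_metric t S UNIV (two_point a b)"
proof -
  have I: "a \<in> {0..1}" "b \<in> {0..1}" using assms by auto
  then have "t a b \<le> 1" "t b a \<le> 1" using t_in[of a b] t_in[of b a] by auto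
  then show ?thesis
    using I assms by (auto simp: S_metric_def two_point_def t_one_left t_one_right)
qed

lemma S_metric_three_point:
  assumes "S \<subseteq> {0..1} \<times> {0..1}" "(1, 1) \<in> S"
    and "(a, b) \<in> S" "(b, a) \<in> S" "(c, d) \<in> S" "(d, c) \<in> S"
    and "(t a c, t b d) \<in> S" "(t b d, t a c) \<in> S"
  shows "S_metric t S {..<3} (three_point t (a, b) (c, d))"
proof -
  have I: "a \<in> {0..1}" "b \<in> {0..1}" "c \<in> {0..1}" "d \<in> {0..1}" using assms by auto
  have one: "x \<in> {0..1} \<Longrightarrow> x \<le> 1" for x :: real by simp
  show ?thesis
    unfolding S_metric_def ball_less_3
    using I assms t_comm[of a c] t_comm[of b d]
    by (auto simp: three_point_def t_in t_one_left t_one_right simp del: atLeastAtMost_iff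
        intro: t_le_leftI t_le_rightI t_in one)
qed

end

section \<open>Suitable sets and the metrics they admit\<close>

lemma S_metric_pullback:
  "S_metric t S Q d \<Longrightarrow> h \<in> R \<rightarrow> Q \<Longrightarrow> S_metric t S R (\<lambda>x y. d (h x) (h y))"
  unfolding S_metric_def by (auto simp: Pi_iff)

lemma S_metric_mono: "S_metric t S Q d \<Longrightarrow> S \<subseteq> S' \<Longrightarrow> S_metric t S' Q d"
  unfolding S_metric_def by auto

text \<open>
  Meets and joins are taken in the unit interval, so that they have the values \<open>1\<close> and \<open>0\<close> for empty
  families.
\<close>

definition meet :: "'i set \<Rightarrow> ('i \<Rightarrow> real) \<Rightarrow> real" where
  "meet I f = Inf (insert 1 (f ` I))"

lemma meet_bdd:
  fixes f :: "'i \<Rightarrow> real"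
  shows "(\<And>i. i \<in> I \<Longrightarrow> f i \<in> {0..1}) \<Longrightarrow> bdd_below (insert 1 (f ` I))"
  by (rule bdd_belowI[of _ 0]) auto

lemma le_meet_iff:
  assumes "\<And>i. i \<in> I \<Longrightarrow> f i \<in> {0..1}"
  shows "c \<le> meet I f \<longleftrightarrow> c \<le> 1 \<and> (\<forall>i\<in>I. c \<le> f i)"
  unfolding meet_def using meet_bdd[of I f] assms by (subst le_cInf_iff) auto

lemma meet_in:
  assumes "\<And>i. i \<in> I \<Longrightarrow> f i \<in> {0..1}"
  shows "meet I f \<in> {0..1}" "i \<in> I \<Longrightarrow> meet I f \<le> f i"
  using le_meet_iff[of I f 0] le_meet_iff[of I f "meet I f"] assms by auto

definition join :: "real set \<Rightarrow> real" where
  "join T = Sup (insert 0 T)"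

lemma join_le_iff:
  assumes "T \<subseteq> {0..1}"
  shows "join T \<le> c \<longleftrightarrow> 0 \<le> c \<and> (\<forall>a\<in>T. a \<le> c)"
  unfolding join_def using assms
  by (subst cSup_le_iff) (auto intro!: bdd_aboveI[of _ 1])

lemma join_in:
  assumes "T \<subseteq> {0..1}"
  shows "join T \<in> {0..1}" "a \<in> T \<Longrightarrow> a \<le> join T"
  using join_le_iff[of T 1] join_le_iff[of T "join T"] assms by auto

text \<open>
  The unit interval is a frame: \<open>min\<close> distributes over joins. This makes the function space distance,
  a join of admissible values, admissible itself.
\<close>

lemma min_join_le:
  assumes T: "T \<subseteq> {0..1}" and le: "\<And>a. a \<in> T \<Longrightarrow> min a c \<le> s" and s: "0 \<le> s"
  shows "min (join T) c \<le> s"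
proof (cases "c \<le> s")
  case False
  then have "\<forall>a\<in>T. a \<le> s" using le by (auto simp: min_le_iff_disj)
  then have "join T \<le> s" using join_le_iff[OF T, of s] s by simp
  then show ?thesis by simp
qed simp

locale enrichment = universe U + t_norm t for U :: "'u set set" and t

locale suitable_enrichment = enrichment U t for U :: "'u set set" and t +
  fixes S
  assumes suitable: "suitable t S"
begin

abbreviation "C \<equiv> unit_Cat_S U t S"

lemma S_unit: "S \<subseteq> {0..1} \<times> {0..1}"
  using suitable by (simp add: suitable_def)

lemma S_Sup: "T \<subseteq> S \<Longrightarrow> (join (fst ` T), join (snd ` T)) \<in> S"
  using suitable by (simp only: suitable_def join_def)

lemma S_Inf: "T \<subseteq> S \<Longrightarrow> (Inf (insert 1 (fst ` T)), Inf (insert 1 (snd ` T))) \<in> S"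
  using suitable by (simp only: suitable_def)

lemma S_sym: "(a, b) \<in> S \<Longrightarrow> (b, a) \<in> S"
  using suitable by (simp add: suitable_def)

lemma S_t: "(a, b) \<in> S \<Longrightarrow> (a', b') \<in> S \<Longrightarrow> (t a a', t b b') \<in> S"
  using suitable by (simp add: suitable_def)

lemma S_one: "(1, 1) \<in> S" using S_Inf[of "{}"] by simp

lemma S_meet:
  assumes "\<And>i. i \<in> I \<Longrightarrow> (f i, g i) \<in> S"
  shows "(meet I f, meet I g) \<in> S"
  using S_Inf[of "(\<lambda>i. (f i, g i)) ` I"] assms
  by (simp add: meet_def image_image image_subset_iff)

lemma S_min:
  assumes "(a, b) \<in> S" "(a', b') \<in> S"
  shows "(min a a', min b b') \<in> S"
proof -
  have *: "meet UNIV (\<lambda>i. if i then x else y) = min x y" if "x \<le> 1" "y \<le> 1" for x y :: real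
    using that by (auto simp: meet_def UNIV_bool cInf_eq_Min min_def)
  have "(meet UNIV (\<lambda>i. if i then a else a'), meet UNIV (\<lambda>i. if i then b else b')) \<in> S"
    by (rule S_meet) (use assms in simp)
  then show ?thesis
    using assms S_unit by (subst (asm) (1 2) *) auto
qed

lemma S_metric_meet:
  assumes d: "\<And>i. i \<in> I \<Longrightarrow> S_metric t S Q (d i)"
  shows "S_metric t S Q (\<lambda>x y. meet I (\<lambda>i. d i x y))"
proof -
  have unit: "d i x y \<in> {0..1}" if "i \<in> I" "x \<in> Q" "y \<in> Q" for i x y
    using d that by (auto simp: S_metric_def)
  have in_unit: "meet I (\<lambda>i. d i x y) \<in> {0..1}" if "x \<in> Q" "y \<in> Q" for x y
    by (rule meet_in(1)) (use unit that in blast)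
  have lower: "meet I (\<lambda>i. d i x y) \<le> d i x y" if "i \<in> I" "x \<in> Q" "y \<in> Q" for i x y
    by (rule meet_in(2)[of I "\<lambda>i. d i x y", OF _ that(1)]) (use unit that in blast)
  show ?thesis
    unfolding S_metric_def
  proof (intro conjI ballI)
    fix x assume x: "x \<in> Q"
    show "meet I (\<lambda>i. d i x x) = 1"
    proof (rule antisym)
      show "meet I (\<lambda>i. d i x x) \<le> 1" using in_unit[OF x x] by simp
      show "1 \<le> meet I (\<lambda>i. d i x x)"
        using d x by (subst le_meet_iff) (auto simp: S_metric_def)
    qed
    fix y assume y: "y \<in> Q"
    show "meet I (\<lambda>i. d i x y) \<in> {0..1}"
      by (rule in_unit[OF x y])
    show "(meet I (\<lambda>i. d i x y), meet I (\<lambda>i. d i y x)) \<in> S"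
      using d x y by (intro S_meet) (auto simp: S_metric_def)
    fix z assume z: "z \<in> Q"
    have "t (meet I (\<lambda>i. d i y z)) (meet I (\<lambda>i. d i x y)) \<le> d i x z" if i: "i \<in> I" for i
    proof -
      have "t (meet I (\<lambda>i. d i y z)) (meet I (\<lambda>i. d i x y)) \<le> t (d i y z) (d i x y)"
        using in_unit lower unit i x y z by (intro t_mono) blast+
      also have "\<dots> \<le> d i x z" using d i x y z by (auto simp: S_metric_def)
      finally show ?thesis .
    qed
    moreover have "t (meet I (\<lambda>i. d i y z)) (meet I (\<lambda>i. d i x y)) \<le> 1"
      using t_in[OF in_unit[OF y z] in_unit[OF x y]] by simp
    ultimately show "t (meet I (\<lambda>i. d i y z)) (meet I (\<lambda>i. d i x y)) \<le> meet I (\<lambda>i. d i x z)"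
      using le_meet_iff[of I "\<lambda>i. d i x z"] unit x z by blast
  qed
qed

text \<open>
  Coreflections and function spaces both take as distance of \<open>x\<close> and \<open>y\<close> the largest element of a
  set \<open>P x y\<close> of admissible pairs. As this join is again admissible, the triangle inequality only
  asks that admissible pairs compose.
\<close>

lemma S_metric_join:
  fixes P :: "'x \<Rightarrow> 'x \<Rightarrow> (real \<times> real) set"
  defines "d \<equiv> \<lambda>x y. join (fst ` P x y)"
  assumes sub: "\<And>x y. x \<in> Q \<Longrightarrow> y \<in> Q \<Longrightarrow> P x y \<subseteq> S"
    and sym: "\<And>x y a b. x \<in> Q \<Longrightarrow> y \<in> Q \<Longrightarrow> (a, b) \<in> P x y \<Longrightarrow> (b, a) \<in> P y x"
    and join: "\<And>x y. x \<in> Q \<Longrightarrow> y \<in> Q \<Longrightarrow> (join (fst ` P x y), join (snd ` P x y)) \<in> P x y"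
    and one: "\<And>x. x \<in> Q \<Longrightarrow> (1, 1) \<in> P x x"
    and tri: "\<And>x y z a b a' b'. x \<in> Q \<Longrightarrow> y \<in> Q \<Longrightarrow> z \<in> Q \<Longrightarrow>
      (a, b) \<in> P x y \<Longrightarrow> (a', b') \<in> P y z \<Longrightarrow> (t a' a, t b' b) \<in> P x z"
  shows "S_metric t S Q d"
    and "\<And>x y. x \<in> Q \<Longrightarrow> y \<in> Q \<Longrightarrow> (d x y, d y x) \<in> P x y"
    and "\<And>x y a b. x \<in> Q \<Longrightarrow> y \<in> Q \<Longrightarrow> (a, b) \<in> P x y \<Longrightarrow> a \<le> d x y"
proof -
  have unit: "fst ` P x y \<subseteq> {0..1}" if "x \<in> Q" "y \<in> Q" for x y
    using sub[OF that] S_unit by auto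
  show le: "a \<le> d x y" if "x \<in> Q" "y \<in> Q" "(a, b) \<in> P x y" for x y a b
    using join_in(2)[OF unit[OF that(1,2)], of a] that(3) unfolding d_def by force
  show mem: "(d x y, d y x) \<in> P x y" if "x \<in> Q" "y \<in> Q" for x y
  proof -
    have "fst ` P y x = snd ` P x y" using sym that by force
    then show ?thesis using join[OF that] by (simp add: d_def)
  qed
  have d1: "d x x = 1" if "x \<in> Q" for x
    using le[OF that that one[OF that]] join_in(1)[OF unit[OF that that]] by (simp add: d_def)
  show "S_metric t S Q d"
    unfolding S_metric_def
  proof (intro conjI ballI)
    fix x y assume xy: "x \<in> Q" "y \<in> Q"
    show "d x y \<in> {0..1}" using join_in(1)[OF unit[OF xy]] by (simp add: d_def)
    show "(d x y, d y x) \<in> S" using mem sub xy by blast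
    fix z assume z: "z \<in> Q"
    show "t (d y z) (d x y) \<le> d x z"
      using le[OF xy(1) z tri[OF xy z mem[OF xy] mem[OF xy(2) z]]] .
  qed (use d1 in blast)
qed

end

lemma Obj_unit_Cat_S':
  "X \<in> Obj (unit_Cat_S U t S) \<longleftrightarrow>
     fst X \<in> U \<and> snd X \<in> extensional (fst X \<times> fst X) \<and> S_metric t S (fst X) (curry (snd X))"
  by (cases X) (simp add: Obj_unit_Cat_S)

lemma composite_ident_right: "g \<in> fst X \<rightarrow>\<^sub>E Y \<Longrightarrow> composite X g (ident X) = g"
  by (rule ext) (auto simp: composite_def compose_def ident_def extensional_def PiE_def)

lemma composite_ident_left: "f \<in> fst Y \<rightarrow>\<^sub>E fst X \<Longrightarrow> composite Y (ident X) f = f"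
  by (rule ext) (auto simp: composite_def compose_def ident_def extensional_def PiE_def Pi_def)

context enrichment
begin

abbreviation "B \<equiv> unit_Cat U t"

lemma B_eq: "B = unit_Cat_S U t ({0..1} \<times> {0..1})"
  by (rule unit_Cat_S_full[symmetric]) simp

lemma Obj_B:
  "X \<in> Obj B \<longleftrightarrow> fst X \<in> U \<and> snd X \<in> extensional (fst X \<times> fst X) \<and>
     S_metric t ({0..1} \<times> {0..1}) (fst X) (curry (snd X))"
  unfolding B_eq by (rule Obj_unit_Cat_S')

lemma Hom_B: "Hom B X Y = (if X \<in> Obj B \<and> Y \<in> Obj B then unit_functors X Y else {})"
  unfolding B_eq by (rule Hom_unit_Cat_S)

lemma Obj_B_eqI:
  assumes "X \<in> Obj B" "Y \<in> Obj B" "fst X = fst Y"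
    and "\<And>x y. x \<in> fst X \<Longrightarrow> y \<in> fst X \<Longrightarrow> snd X (x, y) = snd Y (x, y)"
  shows "X = Y"
proof -
  have "snd X = snd Y"
    by (rule extensionalityI[of _ "fst X \<times> fst X"]) (use assms in \<open>auto simp: Obj_B\<close>)
  with assms(3) show ?thesis by (rule prod_eqI)
qed

end

section \<open>Two-point spaces\<close>

text \<open>One fixed embedding of the two truth values serves for all two-point spaces.\<close>

definition (in universe) pt :: "bool \<Rightarrow> 'u" where
  "pt = (SOME e. inj e \<and> range e \<in> U)"

lemma (in universe) inj_pt: "inj pt" and range_pt: "range pt \<in> U"
proof -
  have "\<exists>e :: bool \<Rightarrow> 'u. inj e \<and> range e \<in> U"
    using smallE[OF small_finite[of "UNIV :: bool set"]] by auto
  then have "inj pt \<and> range pt \<in> U" unfolding pt_def by (rule someI_ex)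
  then show "inj pt" "range pt \<in> U" by auto
qed

context enrichment
begin

text \<open>
  A pair of points of \<open>Y\<close> whose distances are at least \<open>a\<close> and \<open>b\<close> is the same thing as a morphism
  to \<open>Y\<close> from the two-point space with distances \<open>a\<close> and \<open>b\<close>.
\<close>

definition pair_space :: "real \<Rightarrow> real \<Rightarrow> 'u set \<times> ('u \<times> 'u \<Rightarrow> real)" where
  "pair_space a b = transport pt UNIV (two_point a b)"

definition pair_map :: "'u \<Rightarrow> 'u \<Rightarrow> 'u \<Rightarrow> 'u" where
  "pair_map x y = (\<lambda>w\<in>range pt. if w = pt False then x else y)"

lemma pair_map_simps [simp]: "pair_map x y (pt False) = x" "pair_map x y (pt True) = y"
  using inj_pt by (auto simp: pair_map_def inj_eq)

lemma fst_pair_space [simp]: "fst (pair_space a b) = range pt"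
  by (simp add: pair_space_def)

lemma snd_pair_space: "snd (pair_space a b) (pt i, pt j) = two_point a b i j"
  unfolding pair_space_def by (rule snd_transport[OF inj_pt]) auto

lemma pair_space_Obj_B:
  assumes "a \<in> {0..1}" "b \<in> {0..1}" shows "pair_space a b \<in> Obj B"
  unfolding pair_space_def B_eq
  by (rule transport_Obj[OF inj_pt range_pt], rule S_metric_two_point) (use assms in auto)

lemma pair_map_Hom_iff:
  assumes "a \<in> {0..1}" "b \<in> {0..1}" and Y: "Y \<in> Obj B" and xy: "x \<in> fst Y" "y \<in> fst Y"
  shows "pair_map x y \<in> Hom B (pair_space a b) Y \<longleftrightarrow> a \<le> snd Y (x, y) \<and> b \<le> snd Y (y, x)"
proof -
  have "pair_map x y \<in> range pt \<rightarrow>\<^sub>E fst Y"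
    using xy by (auto simp: pair_map_def)
  moreover have "snd Y (x, x) = 1" "snd Y (y, y) = 1"
    using Y xy by (auto simp: Obj_B S_metric_def)
  ultimately show ?thesis
    using Y pair_space_Obj_B[OF assms(1,2)] unit_functors_from_transport[OF inj_pt, of "pair_map x y"]
    by (auto simp: Hom_B pair_space_def two_point_def all_bool_eq)
qed

end


section \<open>Suitable sets define stable subconstructs\<close>

context suitable_enrichment
begin

lemma Obj_C_B: "X \<in> Obj C \<Longrightarrow> X \<in> Obj B"
  using S_unit S_metric_mono unfolding Obj_B Obj_unit_Cat_S' by blast

lemma Hom_C: "X \<in> Obj C \<Longrightarrow> Y \<in> Obj C \<Longrightarrow> Hom C X Y = unit_functors X Y"
  by (simp add: Hom_unit_Cat_S)

text \<open>
  The reflection takes at each pair of points the meet of all larger metrics with values in \<open>S\<close>.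
\<close>

lemma concretely_reflective_C: "concretely_reflective C B"
  unfolding concretely_reflective_def
proof
  fix X :: "'u set \<times> ('u \<times> 'u \<Rightarrow> real)" assume X: "X \<in> Obj B"
  let ?E = "{d. S_metric t S (fst X) d \<and> (\<forall>x\<in>fst X. \<forall>y\<in>fst X. snd X (x, y) \<le> d x y)}"
  define D where "D x y = meet ?E (\<lambda>d. d x y)" for x y
  define R where "R = transport id (fst X) D"
  have unit: "d x y \<in> {0..1}" if "d \<in> ?E" "x \<in> fst X" "y \<in> fst X" for d x y
    using that by (auto simp: S_metric_def)
  have "S_metric t S (fst X) D"
    unfolding D_def by (rule S_metric_meet) simp
  then have R: "R \<in> Obj C"
    unfolding R_def using X by (intro transport_Obj) (auto simp: Obj_B)
  have fst_R: "fst R = fst X" by (simp add: R_def)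
  have snd_R: "snd R (x, y) = D x y" if "x \<in> fst X" "y \<in> fst X" for x y
    using snd_transport[of id "fst X" x y D] that by (simp add: R_def)
  have D_ge: "snd X (x, y) \<le> D x y" if "x \<in> fst X" "y \<in> fst X" for x y
    unfolding D_def using that unit X
    by (subst le_meet_iff) (auto simp: Obj_B S_metric_def)
  have D_le: "D x y \<le> d x y" if "d \<in> ?E" "x \<in> fst X" "y \<in> fst X" for d x y
    unfolding D_def using that unit by (intro meet_in(2)) auto
  have "is_reflection C B X (ident X) R"
    unfolding is_reflection_def
  proof (intro conjI ballI)
    show "ident X \<in> Hom B X R"
      using X Obj_C_B[OF R] D_ge snd_R
      by (auto simp: Hom_B unit_functors_iff ident_def fst_R)
    fix Y f assume Y: "Y \<in> Obj C" and f: "f \<in> Hom B X Y"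
    have f': "f \<in> fst X \<rightarrow>\<^sub>E fst Y"
      "\<And>x y. x \<in> fst X \<Longrightarrow> y \<in> fst X \<Longrightarrow> snd X (x, y) \<le> snd Y (f x, f y)"
      using f by (auto simp: Hom_B unit_functors_iff split: if_splits)
    have "(\<lambda>x y. curry (snd Y) (f x) (f y)) \<in> ?E"
      using S_metric_pullback[of t S "fst Y" "curry (snd Y)" f "fst X"] Y f'
      by (auto simp: Obj_unit_Cat_S')
    from D_le[OF this] have "snd R (x, y) \<le> snd Y (f x, f y)" if "x \<in> fst X" "y \<in> fst X" for x y
      using that by (simp add: snd_R)
    then have "f \<in> Hom C R Y"
      using f'(1) R Y by (simp add: Hom_C unit_functors_iff fst_R)
    moreover have "g = f" if "g \<in> Hom C R Y" "composite X g (ident X) = f" for g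
      using that R Y composite_ident_right[of g X "fst Y"]
      by (auto simp: Hom_C unit_functors_iff fst_R)
    ultimately show "\<exists>!g. g \<in> Hom C R Y \<and> composite X g (ident X) = f"
      using composite_ident_right[OF f'(1)] by blast
  qed (rule R)
  then show "\<exists>R. fst R = fst X \<and> is_reflection C B X (ident X) R"
    using fst_R by blast
qed

text \<open>
  The coreflection can be computed for each pair of points separately: the largest element of \<open>S\<close>
  below the given pair of distances inherits the triangle inequality, since \<open>S\<close> is closed under
  the t-norm.
\<close>

lemma concretely_coreflective_C: "concretely_coreflective C B"
  unfolding concretely_coreflective_def
proof
  fix X :: "'u set \<times> ('u \<times> 'u \<Rightarrow> real)" assume X: "X \<in> Obj B"
  let ?r = "curry (snd X)"
  have r: "?r x y \<in> {0..1}" "?r x x = 1" if "x \<in> fst X" "y \<in> fst X" for x y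
    using X that by (auto simp: Obj_B S_metric_def)
  have tri: "t (?r y z) (?r x y) \<le> ?r x z" if "x \<in> fst X" "y \<in> fst X" "z \<in> fst X" for x y z
    using X that by (auto simp: Obj_B S_metric_def)
  let ?P = "\<lambda>x y. {(a, b) \<in> S. a \<le> ?r x y \<and> b \<le> ?r y x}"
  define D where "D = (\<lambda>x y. join (fst ` ?P x y))"
  define K where "K = transport id (fst X) D"
  have join_P: "(join (fst ` ?P x y), join (snd ` ?P x y)) \<in> ?P x y"
    if "x \<in> fst X" "y \<in> fst X" for x y
  proof -
    have "fst ` ?P x y \<subseteq> {0..1}" "snd ` ?P x y \<subseteq> {0..1}" using S_unit by auto
    then have "join (fst ` ?P x y) \<le> ?r x y" "join (snd ` ?P x y) \<le> ?r y x"
      using r that by (subst join_le_iff; force)+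
    moreover have "(join (fst ` ?P x y), join (snd ` ?P x y)) \<in> S" by (rule S_Sup) auto
    ultimately show ?thesis by simp
  qed
  have tri_P: "(t a' a, t b' b) \<in> ?P x z"
    if xyz: "x \<in> fst X" "y \<in> fst X" "z \<in> fst X" and ab: "(a, b) \<in> ?P x y" "(a', b') \<in> ?P y z"
    for x y z a b a' b'
  proof -
    have I: "a \<in> {0..1}" "b \<in> {0..1}" "a' \<in> {0..1}" "b' \<in> {0..1}" using ab S_unit by auto
    have "t a' a \<le> t (?r y z) (?r x y)" using ab I r xyz by (intro t_mono) auto
    also have "\<dots> \<le> ?r x z" using tri xyz by blast
    finally have 1: "t a' a \<le> ?r x z" .
    have "t b b' \<le> t (?r y x) (?r z y)" using ab I r xyz by (intro t_mono) auto
    also have "\<dots> \<le> ?r z x" using tri xyz by blast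
    finally have 2: "t b' b \<le> ?r z x" using t_comm I by simp
    show ?thesis using 1 2 S_t ab by auto
  qed
  have one_P: "(1, 1) \<in> ?P x x" if "x \<in> fst X" for x using S_one r that by simp
  have sub_P: "?P x y \<subseteq> S" for x y by auto
  have sym_P: "(b, a) \<in> ?P y x" if "(a, b) \<in> ?P x y" for x y a b
    using that S_sym by auto
  note J = S_metric_join[of "fst X" ?P, OF sub_P sym_P join_P one_P tri_P]
  have D: "S_metric t S (fst X) D"
    "\<And>x y. x \<in> fst X \<Longrightarrow> y \<in> fst X \<Longrightarrow> (D x y, D y x) \<in> ?P x y"
    "\<And>x y a b. x \<in> fst X \<Longrightarrow> y \<in> fst X \<Longrightarrow> (a, b) \<in> ?P x y \<Longrightarrow> a \<le> D x y"
    unfolding D_def by (rule J; assumption)+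
  then have K: "K \<in> Obj C"
    unfolding K_def using X by (intro transport_Obj) (auto simp: Obj_B)
  have fst_K: "fst K = fst X" by (simp add: K_def)
  have snd_K: "snd K (x, y) = D x y" if "x \<in> fst X" "y \<in> fst X" for x y
    using snd_transport[of id "fst X" x y D] that by (simp add: K_def)
  have "is_coreflection C B X (ident X) K"
    unfolding is_coreflection_def
  proof (intro conjI ballI)
    show "ident X \<in> Hom B K X"
      using X Obj_C_B[OF K] D(2) snd_K
      by (auto simp: Hom_B unit_functors_iff ident_def fst_K)
    fix Y f assume Y: "Y \<in> Obj C" and f: "f \<in> Hom B Y X"
    have f': "f \<in> fst Y \<rightarrow>\<^sub>E fst X"
      "\<And>x y. x \<in> fst Y \<Longrightarrow> y \<in> fst Y \<Longrightarrow> snd Y (x, y) \<le> snd X (f x, f y)"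
      using f by (auto simp: Hom_B unit_functors_iff split: if_splits)
    have "snd Y (x, y) \<le> D (f x) (f y)" if "x \<in> fst Y" "y \<in> fst Y" for x y
    proof (rule D(3)[of _ _ _ "snd Y (y, x)"])
      show "(snd Y (x, y), snd Y (y, x)) \<in> ?P (f x) (f y)"
        using f'(2) that Y by (auto simp: Obj_unit_Cat_S' S_metric_def)
    qed (use f' that in auto)
    then have "f \<in> Hom C Y K"
      using f'(1) K Y snd_K by (force simp: Hom_C unit_functors_iff fst_K)
    moreover have "g = f" if "g \<in> Hom C Y K" "composite Y (ident X) g = f" for g
      using that K Y composite_ident_left[of g Y X]
      by (auto simp: Hom_C unit_functors_iff fst_K)
    ultimately show "\<exists>!g. g \<in> Hom C Y K \<and> composite Y (ident X) g = f"
      using composite_ident_left[OF f'(1)] by blast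
  qed (rule K)
  then show "\<exists>K. fst K = fst X \<and> is_coreflection C B X (ident X) K"
    using fst_K by blast
qed

lemma stable_C: "stable_subconstruct C B"
  unfolding stable_subconstruct_def subconstruct_def
  using concretely_reflective_C concretely_coreflective_C is_construct_unit_Cat_S Obj_C_B
  by (auto simp: Hom_C Hom_B)

end


section \<open>Every stable subconstruct is defined by a suitable set\<close>

locale stable = enrichment U t for U :: "'u set set" and t +
  fixes A :: "('u, 'u \<times> 'u \<Rightarrow> real) construct"
  assumes stable: "stable_subconstruct A B"
begin

lemma Obj_A_B: "X \<in> Obj A \<Longrightarrow> X \<in> Obj B"
  using stable unfolding stable_subconstruct_def subconstruct_def by blast

lemma Hom_A_B:
  assumes f: "f \<in> Hom A X Y" shows "X \<in> Obj A \<and> Y \<in> Obj A \<and> f \<in> Hom B X Y"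
proof -
  have A: "is_construct A" "\<forall>X\<in>Obj A. \<forall>Y\<in>Obj A. Hom A X Y \<subseteq> Hom B X Y"
    using stable by (simp_all add: stable_subconstruct_def subconstruct_def)
  from A(1) have "\<forall>X Y. X \<notin> Obj A \<or> Y \<notin> Obj A \<longrightarrow> Hom A X Y = {}"
    unfolding is_construct_def by (rule conjunct1)
  then have "X \<in> Obj A" "Y \<in> Obj A" using f by blast+
  then show ?thesis using A(2) f by blast
qed

text \<open>
  An object belongs to \<open>A\<close> as soon as its metric is bounded below by that of every object of \<open>A\<close> on
  the same set to which its morphisms to \<open>A\<close> extend: the reflection is such an object, and its metric
  is also bounded below by the given one.
\<close>

lemma Obj_A_if_initial:
  assumes X: "X \<in> Obj B"
    and initial: "\<And>R x y. R \<in> Obj A \<Longrightarrow> fst R = fst X \<Longrightarrow>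
      (\<And>Y f. Y \<in> Obj A \<Longrightarrow> f \<in> Hom B X Y \<Longrightarrow> f \<in> Hom A R Y) \<Longrightarrow>
      x \<in> fst X \<Longrightarrow> y \<in> fst X \<Longrightarrow> snd R (x, y) \<le> snd X (x, y)"
  shows "X \<in> Obj A"
    and "\<And>Y f. Y \<in> Obj A \<Longrightarrow> f \<in> Hom B X Y \<Longrightarrow> f \<in> Hom A X Y"
proof -
  obtain R where R: "fst R = fst X" "is_reflection A B X (ident X) R"
    using stable X unfolding stable_subconstruct_def concretely_reflective_def by blast
  have RA: "R \<in> Obj A" and id_R: "ident X \<in> Hom B X R" using R(2) by (auto simp: is_reflection_def)
  have factor: "f \<in> Hom A R Y" if "Y \<in> Obj A" "f \<in> Hom B X Y" for Y f
  proof -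
    obtain g where g: "g \<in> Hom A R Y" "composite X g (ident X) = f"
      using R(2) \<open>Y \<in> Obj A\<close> \<open>f \<in> Hom B X Y\<close> unfolding is_reflection_def by blast
    have "g \<in> fst X \<rightarrow>\<^sub>E fst Y"
      using Hom_A_B[OF g(1)] R(1) by (auto simp: Hom_B unit_functors_iff split: if_splits)
    with g show ?thesis using composite_ident_right by metis
  qed
  have "X = R"
  proof (rule Obj_B_eqI[OF X Obj_A_B[OF RA] R(1)[symmetric]])
    fix x y assume xy: "x \<in> fst X" "y \<in> fst X"
    have "snd X (x, y) \<le> snd R (x, y)"
      using id_R xy by (auto simp: Hom_B unit_functors_iff ident_def split: if_splits)
    then show "snd X (x, y) = snd R (x, y)"
      using initial[OF RA R(1) factor xy] by simp
  qed
  then show "X \<in> Obj A" "\<And>Y f. Y \<in> Obj A \<Longrightarrow> f \<in> Hom B X Y \<Longrightarrow> f \<in> Hom A X Y"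
    using RA factor by auto
qed

text \<open>Dually, it suffices that the metric is bounded above by that of the coreflection.\<close>

lemma Obj_A_if_final:
  assumes X: "X \<in> Obj B"
    and final: "\<And>K x y. K \<in> Obj A \<Longrightarrow> fst K = fst X \<Longrightarrow>
      (\<And>Y f. Y \<in> Obj A \<Longrightarrow> f \<in> Hom B Y X \<Longrightarrow> f \<in> Hom A Y K) \<Longrightarrow>
      x \<in> fst X \<Longrightarrow> y \<in> fst X \<Longrightarrow> snd X (x, y) \<le> snd K (x, y)"
  shows "X \<in> Obj A"
proof -
  obtain K where K: "fst K = fst X" "is_coreflection A B X (ident X) K"
    using stable X unfolding stable_subconstruct_def concretely_coreflective_def by blast
  have KA: "K \<in> Obj A" and id_K: "ident X \<in> Hom B K X" using K(2) by (auto simp: is_coreflection_def)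
  have factor: "f \<in> Hom A Y K" if "Y \<in> Obj A" "f \<in> Hom B Y X" for Y f
  proof -
    obtain g where g: "g \<in> Hom A Y K" "composite Y (ident X) g = f"
      using K(2) \<open>Y \<in> Obj A\<close> \<open>f \<in> Hom B Y X\<close> unfolding is_coreflection_def by blast
    have "g \<in> fst Y \<rightarrow>\<^sub>E fst X"
      using Hom_A_B[OF g(1)] K(1) by (auto simp: Hom_B unit_functors_iff split: if_splits)
    with g show ?thesis using composite_ident_left by metis
  qed
  have "X = K"
  proof (rule Obj_B_eqI[OF X Obj_A_B[OF KA] K(1)[symmetric]])
    fix x y assume xy: "x \<in> fst X" "y \<in> fst X"
    have "snd K (x, y) \<le> snd X (x, y)"
      using id_K xy K(1) by (auto simp: Hom_B unit_functors_iff ident_def split: if_splits)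
    then show "snd X (x, y) = snd K (x, y)"
      using final[OF KA K(1) factor xy] by simp
  qed
  then show ?thesis using KA by simp
qed

text \<open>
  An object of \<open>A\<close> is its own reflection, since its identity factors through the reflection.
\<close>

lemma full: "X \<in> Obj A \<Longrightarrow> Y \<in> Obj A \<Longrightarrow> Hom A X Y = Hom B X Y"
proof (intro equalityI subsetI)
  fix f assume X: "X \<in> Obj A" and Y: "Y \<in> Obj A" and f: "f \<in> Hom B X Y"
  have id: "ident X \<in> Hom B X X"
    using Obj_A_B[OF X] by (auto simp: Hom_B unit_functors_iff ident_def)
  show "f \<in> Hom A X Y"
  proof (rule Obj_A_if_initial(2)[OF Obj_A_B[OF X] _ Y f])
    fix R x y
    assume "\<And>Y f. Y \<in> Obj A \<Longrightarrow> f \<in> Hom B X Y \<Longrightarrow> f \<in> Hom A R Y"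
      and fst_R: "fst R = fst X" and xy: "x \<in> fst X" "y \<in> fst X"
    from this(1)[OF X id] have "ident X \<in> Hom B R X" using Hom_A_B by blast
    then show "snd R (x, y) \<le> snd X (x, y)"
      using xy fst_R by (auto simp: Hom_B unit_functors_iff ident_def split: if_splits)
  qed
qed (use Hom_A_B in blast)

text \<open>The object with distances \<open>a\<close> and \<open>b\<close> is a subspace of any object in which these occur.\<close>

lemma pair_space_in_A_if_subspace:
  assumes X: "X \<in> Obj A" "x \<in> fst X" "y \<in> fst X"
  shows "pair_space (snd X (x, y)) (snd X (y, x)) \<in> Obj A" (is "?T \<in> _")
proof (rule Obj_A_if_initial(1))
  have I: "snd X (x, y) \<in> {0..1}" "snd X (y, x) \<in> {0..1}"
    using Obj_A_B[OF X(1)] X(2,3) by (auto simp: Obj_B S_metric_def)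
  then show "?T \<in> Obj B" by (rule pair_space_Obj_B)
  fix R u v assume R: "R \<in> Obj A" "fst R = fst ?T"
    and factor: "\<And>Y f. Y \<in> Obj A \<Longrightarrow> f \<in> Hom B ?T Y \<Longrightarrow> f \<in> Hom A R Y"
    and "u \<in> fst ?T" "v \<in> fst ?T"
  then obtain i j where uv: "u = pt i" "v = pt j" by auto
  have "pair_map x y \<in> Hom B ?T X"
    using pair_map_Hom_iff[OF I Obj_A_B[OF X(1)] X(2,3)] by simp
  then have "pair_map x y \<in> Hom B R X" using factor X(1) Hom_A_B by blast
  then have "snd R (u, v) \<le> snd X (pair_map x y u, pair_map x y v)"
    using R(2) uv by (auto simp: Hom_B unit_functors_iff split: if_splits)
  also have "\<dots> = two_point (snd X (x, y)) (snd X (y, x)) i j"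
    using Obj_A_B[OF X(1)] X(2,3) uv
    by (cases i; cases j) (auto simp: two_point_def Obj_B S_metric_def)
  finally show "snd R (u, v) \<le> snd ?T (u, v)" using uv by (simp add: snd_pair_space)
qed

text \<open>Conversely, every object is final with respect to the pairs of its points.\<close>

lemma Obj_A_if_pair_spaces:
  assumes X: "X \<in> Obj B"
    and pairs: "\<And>x y. x \<in> fst X \<Longrightarrow> y \<in> fst X \<Longrightarrow>
      pair_space (snd X (x, y)) (snd X (y, x)) \<in> Obj A"
  shows "X \<in> Obj A"
proof (rule Obj_A_if_final[OF X])
  fix K x y assume K: "K \<in> Obj A" "fst K = fst X"
    and factor: "\<And>Y f. Y \<in> Obj A \<Longrightarrow> f \<in> Hom B Y X \<Longrightarrow> f \<in> Hom A Y K"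
    and xy: "x \<in> fst X" "y \<in> fst X"
  have I: "snd X (x, y) \<in> {0..1}" "snd X (y, x) \<in> {0..1}"
    using X xy by (auto simp: Obj_B S_metric_def)
  have "pair_map x y \<in> Hom B (pair_space (snd X (x, y)) (snd X (y, x))) X"
    using pair_map_Hom_iff[OF I X xy] by simp
  then have "pair_map x y \<in> Hom B (pair_space (snd X (x, y)) (snd X (y, x))) K"
    using factor pairs[OF xy] Hom_A_B by blast
  then show "snd X (x, y) \<le> snd K (x, y)"
    using pair_map_Hom_iff[OF I Obj_A_B[OF K(1)], of x y] xy K(2) by simp
qed

definition distance_pairs :: "(real \<times> real) set" where
  "distance_pairs = {(a, b). a \<in> {0..1} \<and> b \<in> {0..1} \<and> pair_space a b \<in> Obj A}"

lemma distance_pairs_unit: "distance_pairs \<subseteq> {0..1} \<times> {0..1}"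
  by (auto simp: distance_pairs_def)

lemma distance_pairs_sym: "(a, b) \<in> distance_pairs \<Longrightarrow> (b, a) \<in> distance_pairs"
  using pair_space_in_A_if_subspace[of "pair_space a b" "pt True" "pt False"]
  by (auto simp: distance_pairs_def snd_pair_space two_point_def)

lemma distance_pairs_Inf:
  assumes T: "T \<subseteq> distance_pairs"
  shows "(Inf (insert 1 (fst ` T)), Inf (insert 1 (snd ` T))) \<in> distance_pairs"
proof -
  let ?p = "meet T fst" and ?q = "meet T snd"
  have unit: "fst c \<in> {0..1}" "snd c \<in> {0..1}" if "c \<in> T" for c
    using T distance_pairs_unit that by auto
  have I: "?p \<in> {0..1}" "?q \<in> {0..1}" using meet_in(1)[of T fst] meet_in(1)[of T snd] unit by simp_all
  have "pair_space ?p ?q \<in> Obj A"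
  proof (rule Obj_A_if_initial(1)[OF pair_space_Obj_B[OF I]])
    fix R u v assume R: "R \<in> Obj A" "fst R = fst (pair_space ?p ?q)"
      and factor: "\<And>Y f. Y \<in> Obj A \<Longrightarrow> f \<in> Hom B (pair_space ?p ?q) Y \<Longrightarrow> f \<in> Hom A R Y"
      and "u \<in> fst (pair_space ?p ?q)" "v \<in> fst (pair_space ?p ?q)"
    then obtain i j where uv: "u = pt i" "v = pt j" by auto
    have le: "snd R (pt k, pt l) \<le> two_point a b k l" if c: "(a, b) \<in> T" for a b k l
    proof -
      have ab: "a \<in> {0..1}" "b \<in> {0..1}" "pair_space a b \<in> Obj A" using c T by (auto simp: distance_pairs_def)
      have "?p \<le> a" "?q \<le> b"
        using meet_in(2)[of T fst "(a, b)"] meet_in(2)[of T snd "(a, b)"] unit c by simp_all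
      then have "pair_map (pt False) (pt True) \<in> Hom B (pair_space ?p ?q) (pair_space a b)"
        using pair_map_Hom_iff[OF I Obj_A_B[OF ab(3)]]
        by (simp add: snd_pair_space two_point_def)
      then have "pair_map (pt False) (pt True) \<in> Hom B R (pair_space a b)"
        using factor ab(3) Hom_A_B by blast
      then have "snd R (pt k, pt l)
          \<le> snd (pair_space a b) (pair_map (pt False) (pt True) (pt k), pair_map (pt False) (pt True) (pt l))"
        using R(2) by (auto simp: Hom_B unit_functors_iff split: if_splits)
      moreover have "pair_map (pt False) (pt True) (pt m) = pt m" for m by (cases m) auto
      ultimately show ?thesis by (simp add: snd_pair_space)
    qed
    have one: "snd R (pt k, pt l) \<le> 1" for k l
      using Obj_A_B[OF R(1)] R(2) by (auto simp: Obj_B S_metric_def)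
    have "snd R (pt False, pt True) \<le> ?p" "snd R (pt True, pt False) \<le> ?q"
      using le[of _ _ False True] le[of _ _ True False] one unit
      by (subst le_meet_iff; force simp: two_point_def)+
    then show "snd R (u, v) \<le> snd (pair_space ?p ?q) (u, v)"
      using uv one by (cases i; cases j) (auto simp: snd_pair_space two_point_def)
  qed
  then show ?thesis using I by (simp add: distance_pairs_def meet_def)
qed

lemma distance_pairs_Sup:
  assumes T: "T \<subseteq> distance_pairs"
  shows "(join (fst ` T), join (snd ` T)) \<in> distance_pairs"
proof -
  let ?p = "join (fst ` T)" and ?q = "join (snd ` T)"
  have unit: "fst ` T \<subseteq> {0..1}" "snd ` T \<subseteq> {0..1}" using T distance_pairs_unit by auto
  have I: "?p \<in> {0..1}" "?q \<in> {0..1}" using join_in(1) unit by blast+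
  have "pair_space ?p ?q \<in> Obj A"
  proof (rule Obj_A_if_final[OF pair_space_Obj_B[OF I]])
    fix K u v assume K: "K \<in> Obj A" "fst K = fst (pair_space ?p ?q)"
      and factor: "\<And>Y f. Y \<in> Obj A \<Longrightarrow> f \<in> Hom B Y (pair_space ?p ?q) \<Longrightarrow> f \<in> Hom A Y K"
      and "u \<in> fst (pair_space ?p ?q)" "v \<in> fst (pair_space ?p ?q)"
    then obtain i j where uv: "u = pt i" "v = pt j" by auto
    have KB: "K \<in> Obj B" using K(1) by (rule Obj_A_B)
    have le: "a \<le> snd K (pt False, pt True) \<and> b \<le> snd K (pt True, pt False)" if c: "(a, b) \<in> T" for a b
    proof -
      have ab: "a \<in> {0..1}" "b \<in> {0..1}" "pair_space a b \<in> Obj A" using c T by (auto simp: distance_pairs_def)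
      have "a \<le> ?p" "b \<le> ?q" using join_in(2)[OF unit(1)] join_in(2)[OF unit(2)] c by force+
      then have "pair_map (pt False) (pt True) \<in> Hom B (pair_space a b) (pair_space ?p ?q)"
        using pair_map_Hom_iff[OF ab(1,2) pair_space_Obj_B[OF I]]
        by (simp add: snd_pair_space two_point_def)
      then have "pair_map (pt False) (pt True) \<in> Hom B (pair_space a b) K"
        using factor ab(3) Hom_A_B by blast
      then show ?thesis
        using pair_map_Hom_iff[OF ab(1,2) KB] K(2) by simp
    qed
    have zero: "0 \<le> snd K (pt k, pt l)" and diag: "snd K (pt k, pt k) = 1" for k l
      using KB K(2) by (auto simp: Obj_B S_metric_def)
    have "?p \<le> snd K (pt False, pt True)" "?q \<le> snd K (pt True, pt False)"
      using le zero by (subst join_le_iff[OF unit(1)] join_le_iff[OF unit(2)]; force)+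
    then show "snd (pair_space ?p ?q) (u, v) \<le> snd K (u, v)"
      using uv diag by (cases i; cases j) (auto simp: snd_pair_space two_point_def)
  qed
  then show ?thesis using I by (simp add: distance_pairs_def)
qed

text \<open>
  The three-point space is glued from its two steps, hence belongs to \<open>A\<close>; the composite of the
  steps then occurs as a pair of distances in an object of \<open>A\<close>.
\<close>

lemma distance_pairs_t:
  assumes p: "(a, b) \<in> distance_pairs" and q: "(c, d) \<in> distance_pairs"
  shows "(t a c, t b d) \<in> distance_pairs"
proof -
  have I: "a \<in> {0..1}" "b \<in> {0..1}" "c \<in> {0..1}" "d \<in> {0..1}" "t a c \<in> {0..1}" "t b d \<in> {0..1}"
    using p q t_in[of a c] t_in[of b d] by (auto simp: distance_pairs_def)
  obtain g :: "nat \<Rightarrow> 'u" where g: "inj_on g {..<3}" "g ` {..<3} \<in> U"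
    using smallE[OF small_finite[of "{..<3::nat}"]] by blast
  define X where "X = transport g {..<3} (three_point t (a, b) (c, d))"
  have fst_X: "fst X = {g 0, g 1, g 2}"
    unfolding X_def by (auto simp: numeral_eq_Suc lessThan_Suc)
  have snd_X: "snd X (g i, g j) = three_point t (a, b) (c, d) i j" if "i < 3" "j < 3" for i j
    unfolding X_def by (rule snd_transport[OF g(1)]) (use that in auto)
  have X: "X \<in> Obj B"
    unfolding X_def B_eq
    by (rule transport_Obj[OF g], rule S_metric_three_point) (use I in auto)
  have "X \<in> Obj A"
  proof (rule Obj_A_if_final[OF X])
    fix K u v assume K: "K \<in> Obj A" "fst K = fst X"
      and factor: "\<And>Y f. Y \<in> Obj A \<Longrightarrow> f \<in> Hom B Y X \<Longrightarrow> f \<in> Hom A Y K"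
      and uv: "u \<in> fst X" "v \<in> fst X"
    have KB: "K \<in> Obj B" using K(1) by (rule Obj_A_B)
    have edge: "a \<le> snd K (x, y) \<and> b \<le> snd K (y, x)"
      if "(a, b) \<in> distance_pairs" "x \<in> fst X" "y \<in> fst X" "a \<le> snd X (x, y)" "b \<le> snd X (y, x)" for a b x y
    proof -
      have ab: "a \<in> {0..1}" "b \<in> {0..1}" "pair_space a b \<in> Obj A" using that by (auto simp: distance_pairs_def)
      have "pair_map x y \<in> Hom B (pair_space a b) X"
        using pair_map_Hom_iff[OF ab(1,2) X that(2,3)] that by simp
      then have "pair_map x y \<in> Hom B (pair_space a b) K"
        using factor ab(3) Hom_A_B by blast
      then show ?thesis
        using pair_map_Hom_iff[OF ab(1,2) KB] K(2) that by simp
    qed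
    have 01: "a \<le> snd K (g 0, g 1)" "b \<le> snd K (g 1, g 0)"
      using edge[OF p, of "g 0" "g 1"] by (auto simp: fst_X snd_X three_point_def)
    have 12: "c \<le> snd K (g 1, g 2)" "d \<le> snd K (g 2, g 1)"
      using edge[OF q, of "g 1" "g 2"] by (auto simp: fst_X snd_X three_point_def)
    have diag: "snd K (g 0, g 0) = 1" "snd K (g 1, g 1) = 1" "snd K (g 2, g 2) = 1"
      using KB K(2) by (auto simp: Obj_B S_metric_def fst_X)
    have Kd: "snd K (x, y) \<in> {0..1}"
      "t (snd K (y, z)) (snd K (x, y)) \<le> snd K (x, z)"
      if "x \<in> fst X" "y \<in> fst X" "z \<in> fst X" for x y z
      using KB K(2) that by (auto simp: Obj_B S_metric_def)
    have "t c a \<le> t (snd K (g 1, g 2)) (snd K (g 0, g 1))"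
      using 01 12 I Kd(1) by (intro t_mono) (auto simp: fst_X)
    then have 02: "t a c \<le> snd K (g 0, g 2)"
      using Kd(2)[of "g 0" "g 1" "g 2"] t_comm[of a c] I by (auto simp: fst_X)
    have "t b d \<le> t (snd K (g 1, g 0)) (snd K (g 2, g 1))"
      using 01 12 I Kd(1) by (intro t_mono) (auto simp: fst_X)
    then have 20: "t b d \<le> snd K (g 2, g 0)"
      using Kd(2)[of "g 2" "g 1" "g 0"] by (auto simp: fst_X)
    show "snd X (u, v) \<le> snd K (u, v)"
      using uv 01 12 02 20 diag unfolding fst_X
      by (auto simp: snd_X three_point_def)
  qed
  then have "pair_space (snd X (g 0, g 2)) (snd X (g 2, g 0)) \<in> Obj A"
    by (rule pair_space_in_A_if_subspace) (auto simp: fst_X)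
  moreover have "snd X (g 0, g 2) = t a c" "snd X (g 2, g 0) = t b d"
    by (simp_all add: snd_X three_point_def)
  ultimately show ?thesis
    using I(5,6) by (simp add: distance_pairs_def)
qed

lemma suitable_distance_pairs: "suitable t distance_pairs"
  unfolding suitable_def
  using distance_pairs_unit distance_pairs_Sup[unfolded join_def] distance_pairs_Inf distance_pairs_sym distance_pairs_t by simp

lemma A_eq_unit_Cat_S: "A = unit_Cat_S U t distance_pairs"
proof -
  have obj: "X \<in> Obj A \<longleftrightarrow> X \<in> Obj (unit_Cat_S U t distance_pairs)" for X
  proof
    assume X: "X \<in> Obj A"
    then have "(snd X (x, y), snd X (y, x)) \<in> distance_pairs" if "x \<in> fst X" "y \<in> fst X" for x y
      using pair_space_in_A_if_subspace[OF X that] Obj_A_B[OF X] that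
      by (auto simp: distance_pairs_def Obj_B S_metric_def)
    then show "X \<in> Obj (unit_Cat_S U t distance_pairs)"
      using Obj_A_B[OF X] by (auto simp: Obj_unit_Cat_S' Obj_B S_metric_def)
  next
    assume X: "X \<in> Obj (unit_Cat_S U t distance_pairs)"
    then have "S_metric t ({0..1} \<times> {0..1}) (fst X) (curry (snd X))"
      using S_metric_mono[OF _ distance_pairs_unit] by (auto simp: Obj_unit_Cat_S')
    then have "X \<in> Obj B" using X by (auto simp: Obj_B Obj_unit_Cat_S')
    then show "X \<in> Obj A"
      by (rule Obj_A_if_pair_spaces) (use X in \<open>auto simp: Obj_unit_Cat_S' S_metric_def distance_pairs_def\<close>)
  qed
  have "Hom A X Y = Hom (unit_Cat_S U t distance_pairs) X Y" for X Y
  proof (cases "X \<in> Obj A \<and> Y \<in> Obj A")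
    case True
    then show ?thesis
      using full[of X Y] obj Obj_A_B by (auto simp: Hom_B Hom_unit_Cat_S)
  next
    case False
    then have "Hom A X Y = {}" using Hom_A_B by blast
    then show ?thesis using False by (auto simp: Hom_unit_Cat_S obj)
  qed
  then have "Hom A = Hom (unit_Cat_S U t distance_pairs)" by (intro ext)
  moreover have "Obj A = Obj (unit_Cat_S U t distance_pairs)" using obj by blast
  ultimately show ?thesis by (intro construct.equality) auto
qed

theorem ex_suitable: "\<exists>S. suitable t S \<and> A = unit_Cat_S U t S"
  using suitable_distance_pairs A_eq_unit_Cat_S by blast

end

section \<open>Cartesian closedness forces idempotent squares\<close>

lemma binary_product_Obj:
  assumes "is_binary_product D X Z P p q"
  shows "P \<in> Obj D" "p \<in> Hom D P X" "q \<in> Hom D P Z"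
proof -
  from assms have *: "P \<in> Obj D" "\<forall>i\<in>UNIV. (if i then p else q) \<in> Hom D P (if i then X else Z)"
    unfolding is_binary_product_def is_product_def by blast+
  show "P \<in> Obj D" "p \<in> Hom D P X" "q \<in> Hom D P Z"
    using *(1) *(2)[rule_format, of True] *(2)[rule_format, of False] by simp_all
qed

lemma binary_product_ump:
  assumes "is_binary_product D X Z P p q" "W \<in> Obj D" "f \<in> Hom D W X" "g \<in> Hom D W Z"
  shows "\<exists>!m. m \<in> Hom D W P \<and> composite W p m = f \<and> composite W q m = g"
proof -
  from assms(1) have "\<forall>W\<in>Obj D. \<forall>h. (\<forall>i\<in>UNIV. h i \<in> Hom D W (if i then X else Z)) \<longrightarrow>
      (\<exists>!m. m \<in> Hom D W P \<and> (\<forall>i\<in>UNIV. composite W (if i then p else q) m = h i))"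
    unfolding is_binary_product_def is_product_def by (elim conjE)
  from this[rule_format, OF assms(2), of "\<lambda>i. if i then f else g"]
  show ?thesis using assms(3,4) by (simp add: all_bool_eq)
qed

context suitable_enrichment
begin

lemma pair_space_Obj_C: "(a, b) \<in> S \<Longrightarrow> pair_space a b \<in> Obj C"
  unfolding pair_space_def
  by (rule transport_Obj[OF inj_pt range_pt S_metric_two_point[OF S_unit S_one _ S_sym]])

lemma pair_map_Hom_C:
  assumes "(a, b) \<in> S" "Y \<in> Obj C" "x \<in> fst Y" "y \<in> fst Y"
  shows "pair_map x y \<in> Hom C (pair_space a b) Y \<longleftrightarrow> a \<le> snd Y (x, y) \<and> b \<le> snd Y (y, x)"
  using pair_map_Hom_iff[of a b Y x y] assms S_unit Obj_C_B pair_space_Obj_C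
  by (auto simp: Hom_B Hom_C)

lemma Obj_C_metric:
  assumes "X \<in> Obj C" "x \<in> fst X" "y \<in> fst X"
  shows "snd X (x, y) \<in> {0..1}" "snd X (x, x) = 1" "(snd X (x, y), snd X (y, x)) \<in> S"
    "z \<in> fst X \<Longrightarrow> t (snd X (y, z)) (snd X (x, y)) \<le> snd X (x, z)"
  using assms by (auto simp: Obj_unit_Cat_S' S_metric_def)

lemma Hom_C_D:
  assumes "f \<in> Hom C X Y"
  shows "X \<in> Obj C" "Y \<in> Obj C" "f \<in> fst X \<rightarrow>\<^sub>E fst Y" "x \<in> fst X \<Longrightarrow> f x \<in> fst Y"
    "x \<in> fst X \<Longrightarrow> x' \<in> fst X \<Longrightarrow> snd X (x, x') \<le> snd Y (f x, f x')"
  using assms by (auto simp: Hom_unit_Cat_S unit_functors_iff split: if_splits)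

lemma Hom_C_I:
  assumes "X \<in> Obj C" "Y \<in> Obj C" "f \<in> fst X \<rightarrow>\<^sub>E fst Y"
    "\<And>x x'. x \<in> fst X \<Longrightarrow> x' \<in> fst X \<Longrightarrow> snd X (x, x') \<le> snd Y (f x, f x')"
  shows "f \<in> Hom C X Y"
  using assms by (auto simp: Hom_unit_Cat_S unit_functors_iff)

definition point :: "'u set \<times> ('u \<times> 'u \<Rightarrow> real)" where
  "point = transport pt {True} (\<lambda>_ _. 1)"

lemma point_Obj: "point \<in> Obj C"
  unfolding point_def
proof (rule transport_Obj)
  show "pt ` {True} \<in> U" by (rule subset_in_U[OF range_pt]) auto
  show "S_metric t S {True} (\<lambda>_ _. 1)"
    using S_one t_one_left[of 1] by (simp add: S_metric_def)
qed simp

lemma fst_point: "fst point = {pt True}" by (simp add: point_def)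

lemma const_Hom_C:
  assumes "X \<in> Obj C" "x \<in> fst X"
  shows "(\<lambda>w\<in>{pt True}. x) \<in> Hom C point X"
proof (rule Hom_C_I)
  fix w w' assume "w \<in> fst point" "w' \<in> fst point"
  then show "snd point (w, w') \<le> snd X ((\<lambda>w\<in>{pt True}. x) w, (\<lambda>w\<in>{pt True}. x) w')"
    using Obj_C_metric(2)[OF assms assms(2)] snd_transport[of pt "{True}" True True]
    by (simp add: fst_point) (simp add: point_def)
qed (use assms point_Obj fst_point in auto)

text \<open>
  Whatever object represents a binary product, its points and distances are those of the cartesian
  product with the minimum metric: both can be tested with maps out of a point and out of two-point
  spaces.
\<close>

context
  fixes X Z P p q
  assumes prod: "is_binary_product C X Z P p q"
    and X: "X \<in> Obj C" and Z: "Z \<in> Obj C"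
begin

lemmas prod_facts = binary_product_Obj[OF prod]
lemmas p_facts = Hom_C_D[OF prod_facts(2)]
lemmas q_facts = Hom_C_D[OF prod_facts(3)]

lemma product_point:
  assumes "x \<in> fst X" "z \<in> fst Z"
  obtains w where "w \<in> fst P" "p w = x" "q w = z"
proof -
  obtain m where m: "m \<in> Hom C point P"
    "composite point p m = (\<lambda>w\<in>{pt True}. x)" "composite point q m = (\<lambda>w\<in>{pt True}. z)"
    using binary_product_ump[OF prod point_Obj const_Hom_C[OF X assms(1)] const_Hom_C[OF Z assms(2)]]
    by blast
  show ?thesis
  proof
    show "m (pt True) \<in> fst P" using Hom_C_D(4)[OF m(1)] by (simp add: fst_point)
    show "p (m (pt True)) = x" "q (m (pt True)) = z"
      using fun_cong[OF m(2), of "pt True"] fun_cong[OF m(3), of "pt True"]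
      by (simp_all add: composite_def compose_def fst_point)
  qed
qed

lemma product_point_unique:
  assumes w: "w \<in> fst P" "w' \<in> fst P" and eq: "p w = p w'" "q w = q w'"
  shows "w = w'"
proof -
  let ?c = "\<lambda>v. \<lambda>w\<in>{pt True}. v"
  have "composite point p (?c w) = ?c (p w)" "composite point q (?c w) = ?c (q w)" for w
    by (auto simp: composite_def compose_def fst_point fun_eq_iff)
  then have "?c w = ?c w'"
    using binary_product_ump[OF prod point_Obj const_Hom_C[OF X p_facts(4)[OF w(1)]]
        const_Hom_C[OF Z q_facts(4)[OF w(1)]]]
      const_Hom_C[OF prod_facts(1)] w eq by metis
  from fun_cong[OF this, of "pt True"] show ?thesis by simp
qed

lemma product_dist:
  assumes w: "w \<in> fst P" "w' \<in> fst P"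
  shows "min (snd X (p w, p w')) (snd Z (q w, q w')) \<le> snd P (w, w')"
proof -
  let ?d = "\<lambda>w w'. min (snd X (p w, p w')) (snd Z (q w, q w'))"
  have pq: "p w \<in> fst X" "p w' \<in> fst X" "q w \<in> fst Z" "q w' \<in> fst Z"
    using w p_facts q_facts by auto
  have d: "(?d w w', ?d w' w) \<in> S"
    using Obj_C_metric(3)[OF X] Obj_C_metric(3)[OF Z] pq by (intro S_min) auto
  have "pair_map (p w) (p w') \<in> Hom C (pair_space (?d w w') (?d w' w)) X"
    "pair_map (q w) (q w') \<in> Hom C (pair_space (?d w w') (?d w' w)) Z"
    using pair_map_Hom_C[OF d X pq(1,2)] pair_map_Hom_C[OF d Z pq(3,4)] by auto
  then obtain m where m: "m \<in> Hom C (pair_space (?d w w') (?d w' w)) P"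
    "composite (pair_space (?d w w') (?d w' w)) p m = pair_map (p w) (p w')"
    "composite (pair_space (?d w w') (?d w' w)) q m = pair_map (q w) (q w')"
    using binary_product_ump[OF prod pair_space_Obj_C[OF d]] by blast
  have "m (pt i) \<in> fst P" "p (m (pt i)) = pair_map (p w) (p w') (pt i)"
      "q (m (pt i)) = pair_map (q w) (q w') (pt i)" for i
    using fun_cong[OF m(2), of "pt i"] fun_cong[OF m(3), of "pt i"] Hom_C_D(4)[OF m(1), of "pt i"]
    by (simp_all add: composite_def compose_def)
  from this[of False] this[of True] have "m (pt False) = w" "m (pt True) = w'"
    using product_point_unique w by auto
  then show ?thesis
    using Hom_C_D(5)[OF m(1), of "pt False" "pt True"] by (simp add: snd_pair_space two_point_def)
qed

end

end

text \<open>
  For \<open>p = (a, b)\<close> and \<open>q = (c, d)\<close> these are the distances in a square: forth, the sides \<open>0\<close>--\<open>1\<close> and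
  \<open>2\<close>--\<open>3\<close> have length \<open>a\<close> and the other distances are \<open>c\<close>, except that the corners \<open>0\<close> and \<open>3\<close> are
  only as close as the paths through \<open>1\<close> and through \<open>2\<close> make them; back, likewise with \<open>b\<close> and \<open>d\<close>.
\<close>

definition four_step :: "(real \<Rightarrow> real \<Rightarrow> real) \<Rightarrow> real \<Rightarrow> real \<Rightarrow> nat \<Rightarrow> nat \<Rightarrow> real" where
  "four_step t a c i j =
     (if i = 0 \<and> j = 1 \<or> i = 2 \<and> j = 3 then a else if i = 0 \<and> j = 3 then t c a else c)"

definition four_point ::
  "(real \<Rightarrow> real \<Rightarrow> real) \<Rightarrow> real \<times> real \<Rightarrow> real \<times> real \<Rightarrow> nat \<Rightarrow> nat \<Rightarrow> real" where
  "four_point t p q i j =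
     (if i = j then 1 else if i < j then four_step t (fst p) (fst q) i j
      else four_step t (snd p) (snd q) j i)"

lemma ball_less_4: "(\<forall>x\<in>{..<4::nat}. P x) \<longleftrightarrow> P 0 \<and> P 1 \<and> P 2 \<and> P 3"
  by (auto simp: numeral_eq_Suc less_Suc_eq)

lemma (in t_norm) S_metric_four_point:
  assumes "S \<subseteq> {0..1} \<times> {0..1}" "(1, 1) \<in> S"
    and "(a, b) \<in> S" "(b, a) \<in> S" "(c, d) \<in> S" "(d, c) \<in> S"
    and "(t c a, t d b) \<in> S" "(t d b, t c a) \<in> S" and le: "c \<le> a" "d \<le> b"
  shows "S_metric t S {..<4} (four_point t (a, b) (c, d))"
proof -
  have I: "a \<in> {0..1}" "b \<in> {0..1}" "c \<in> {0..1}" "d \<in> {0..1}" using assms by auto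
  have one: "x \<in> {0..1} \<Longrightarrow> x \<le> 1" for x :: real by simp
  show ?thesis
    unfolding S_metric_def ball_less_4
    using I assms t_comm[of a c] t_comm[of b d]
    by (auto simp: four_point_def four_step_def t_in t_one_left t_one_right
        simp del: atLeastAtMost_iff intro: t_le_leftI t_le_rightI t_in one)
qed

context suitable_enrichment
begin

text \<open>
  Let \<open>c = t a a\<close>, and let \<open>Z\<close> be the three-point space in which two steps of length \<open>a\<close> compose.
  It is glued from two two-point spaces, and if \<open>X \<times> -\<close> has a right adjoint, then \<open>X \<times> Z\<close> is glued
  from the corresponding products. For \<open>X\<close> the two-point space with distance \<open>c\<close> this says that the
  diagonal distance \<open>c\<close> of the product is attained along a path from one corner to the other, which
  moves by \<open>c\<close> in one step and by \<open>a\<close> in another. So \<open>c \<le> t c a\<close>, whence \<open>c\<close> is idempotent.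
  The space \<open>Y\<close> below is the four-point quotient of \<open>X \<times> Z\<close>
  in which these paths determine the distance of the two corners.
\<close>

lemma cartesian_closed_imp_in_M:
  assumes cc: "cartesian_closed C" and ab: "(a, b) \<in> S"
  shows "a \<in> M t"
proof -
  define c d where "c = t a a" and "d = t b b"
  have I: "a \<in> {0..1}" "b \<in> {0..1}" using ab S_unit by auto
  have cd: "(c, d) \<in> S" unfolding c_def d_def by (rule S_t[OF ab ab])
  have Icd: "c \<in> {0..1}" "d \<in> {0..1}" using cd S_unit by auto
  have c_le: "c \<le> a" and d_le: "d \<le> b" using t_le_left I by (auto simp: c_def d_def)

  define X where "X = pair_space c d"
  define W where "W = pair_space a b"
  obtain g :: "nat \<Rightarrow> 'u" where g: "inj_on g {..<3}" "g ` {..<3} \<in> U"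
    using smallE[OF small_finite[of "{..<3::nat}"]] by blast
  define Z where "Z = transport g {..<3} (three_point t (a, b) (a, b))"
  obtain k :: "nat \<Rightarrow> 'u" where k: "inj_on k {..<4}" "k ` {..<4} \<in> U"
    using smallE[OF small_finite[of "{..<4::nat}"]] by blast
  define Y where "Y = transport k {..<4} (four_point t (a, b) (c, d))"

  have X: "X \<in> Obj C" and W: "W \<in> Obj C"
    unfolding X_def W_def by (rule pair_space_Obj_C, rule cd, rule pair_space_Obj_C, rule ab)
  have Z: "Z \<in> Obj C" unfolding Z_def
    by (rule transport_Obj[OF g S_metric_three_point[OF S_unit S_one]])
      (use ab cd S_sym in \<open>auto simp: c_def[symmetric] d_def[symmetric]\<close>)
  have Y: "Y \<in> Obj C" unfolding Y_def
    by (rule transport_Obj[OF k S_metric_four_point[OF S_unit S_one]])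
      (use ab cd S_sym S_t[OF cd ab] c_le d_le in auto)
  have fst_Z: "fst Z = {g 0, g 1, g 2}"
    unfolding Z_def by (auto simp: numeral_eq_Suc lessThan_Suc)
  have g_neq: "g 0 \<noteq> g 1" "g 1 \<noteq> g 2" "g 0 \<noteq> g 2"
    using g(1) by (simp_all add: inj_on_eq_iff)
  have snd_Z: "snd Z (g i, g j) = three_point t (a, b) (a, b) i j" if "i < 3" "j < 3" for i j
    unfolding Z_def by (rule snd_transport[OF g(1)]) (use that in auto)
  have snd_Y: "snd Y (k i, k j) = four_point t (a, b) (c, d) i j" if "i < 4" "j < 4" for i j
    unfolding Y_def by (rule snd_transport[OF k(1)]) (use that in auto)

  obtain F G where F: "is_product_functor C X F" and adj: "right_adjoint C C F G"
    using cc X unfolding cartesian_closed_def by blast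
  obtain p q where prod: "\<And>V. V \<in> Obj C \<Longrightarrow> is_binary_product C X V (on_obj F V) (p V) (q V)"
    and nat_p: "\<And>V V' f. V \<in> Obj C \<Longrightarrow> V' \<in> Obj C \<Longrightarrow> f \<in> Hom C V V' \<Longrightarrow>
      composite (on_obj F V) (p V') (on_mor F V V' f) = p V"
    and nat_q: "\<And>V V' f. V \<in> Obj C \<Longrightarrow> V' \<in> Obj C \<Longrightarrow> f \<in> Hom C V V' \<Longrightarrow>
      composite (on_obj F V) (q V') (on_mor F V V' f) = composite (on_obj F V) f (q V)"
    using F unfolding is_product_functor_def by blast
  have F_mor: "on_mor F V V' f \<in> Hom C (on_obj F V) (on_obj F V')" if "f \<in> Hom C V V'" for V V' f
  proof -
    have "is_functor C C F" using F by (simp add: is_product_functor_def)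
    then show ?thesis using that Hom_C_D(1,2)[OF that] by (simp add: is_functor_def)
  qed
  have F_p: "p V' (on_mor F V V' f w) = p V w" and F_q: "q V' (on_mor F V V' f w) = f (q V w)"
    if "f \<in> Hom C V V'" "w \<in> fst (on_obj F V)" for V V' f w
    using fun_cong[OF nat_p[OF Hom_C_D(1,2)[OF that(1)] that(1)], of w]
      fun_cong[OF nat_q[OF Hom_C_D(1,2)[OF that(1)] that(1)], of w] that(2)
    by (simp_all add: composite_def compose_def)
  define E where "E = on_obj G Y"
  obtain \<phi> where bij: "\<And>V. V \<in> Obj C \<Longrightarrow> bij_betw (\<phi> V) (Hom C (on_obj F V) Y) (Hom C V E)"
    and nat_\<phi>: "\<And>V V' h f. V \<in> Obj C \<Longrightarrow> V' \<in> Obj C \<Longrightarrow> h \<in> Hom C V' V \<Longrightarrow>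
      f \<in> Hom C (on_obj F V) Y \<Longrightarrow>
      \<phi> V' (composite (on_obj F V') f (on_mor F V' V h)) = composite V' (\<phi> V f) h"
  proof -
    obtain \<psi> where
      "\<forall>V\<in>Obj C. \<forall>Y\<in>Obj C. bij_betw (\<psi> V Y) (Hom C (on_obj F V) Y) (Hom C V (on_obj G Y))"
      "\<forall>V\<in>Obj C. \<forall>V'\<in>Obj C. \<forall>Y\<in>Obj C. \<forall>h\<in>Hom C V' V. \<forall>f\<in>Hom C (on_obj F V) Y.
         \<psi> V' Y (composite (on_obj F V') f (on_mor F V' V h)) = composite V' (\<psi> V Y f) h"
      using adj unfolding right_adjoint_def by blast
    then show ?thesis using Y by (intro that[of "\<lambda>V. \<psi> V Y"]) (auto simp: E_def)
  qed

  define \<iota>1 \<iota>2 where "\<iota>1 = pair_map (g 0) (g 1)" and "\<iota>2 = pair_map (g 1) (g 2)"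
  have \<iota>: "\<iota>1 \<in> Hom C W Z" "\<iota>2 \<in> Hom C W Z"
    unfolding \<iota>1_def \<iota>2_def W_def
    by (subst pair_map_Hom_C[OF ab Z]; simp add: fst_Z snd_Z three_point_def)+

  \<comment> \<open>the quotient map from \<open>X \<times> Z\<close> onto \<open>Y\<close>\<close>
  define N where "N x z = k (if x = pt False then if z = g 0 then 0 else 1
    else if z = g 2 then 3 else 2)" for x z
  have N_\<iota>: "N (pt j) (\<iota>1 (pt l)) = k (if j then 2 else if l then 1 else 0)"
    "N (pt j) (\<iota>2 (pt l)) = k (if j then if l then 3 else 2 else 1)" for j l
    using g_neq inj_eq[OF inj_pt, of j False]
    by (cases j; cases l; simp add: N_def \<iota>1_def \<iota>2_def)+
  define f where "f = (\<lambda>w\<in>fst (on_obj F Z). N (p Z w) (q Z w))"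
  have f_\<iota>: "composite (on_obj F W) f (on_mor F W Z i) \<in> Hom C (on_obj F W) Y"
    if i: "i = \<iota>1 \<or> i = \<iota>2" for i
  proof (rule Hom_C_I[OF binary_product_Obj(1)[OF prod[OF W]] Y])
    have iH: "i \<in> Hom C W Z" using i \<iota> by blast
    have val: "composite (on_obj F W) f (on_mor F W Z i) w = N (p W w) (i (q W w))"
      if "w \<in> fst (on_obj F W)" for w
      using that F_p[OF iH that] F_q[OF iH that] Hom_C_D(4)[OF F_mor[OF iH] that]
      by (simp add: composite_def compose_def f_def)
    have N_Y: "N x z \<in> fst Y" for x z by (simp add: N_def Y_def)
    show "composite (on_obj F W) f (on_mor F W Z i) \<in> fst (on_obj F W) \<rightarrow>\<^sub>E fst Y"
    proof (rule PiE_I)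
      fix w assume "w \<in> fst (on_obj F W)"
      then show "composite (on_obj F W) f (on_mor F W Z i) w \<in> fst Y" using val N_Y by simp
    qed (simp add: composite_def compose_def)
    fix w w' assume w: "w \<in> fst (on_obj F W)" "w' \<in> fst (on_obj F W)"
    have pH: "p W \<in> Hom C (on_obj F W) X" and qH: "q W \<in> Hom C (on_obj F W) W"
      using binary_product_Obj[OF prod[OF W]] by blast+
    obtain j l j' l' where jl: "p W w = pt j" "q W w = pt l" "p W w' = pt j'" "q W w' = pt l'"
      using Hom_C_D(4)[OF pH] Hom_C_D(4)[OF qH] w unfolding X_def W_def by (metis fst_pair_space rangeE)
    have "snd (on_obj F W) (w, w') \<le> min (two_point c d j j') (two_point a b l l')"
      using Hom_C_D(5)[OF pH w] Hom_C_D(5)[OF qH w] jl by (simp add: X_def W_def snd_pair_space)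
    also have "\<dots> \<le> snd Y (N (pt j) (i (pt l)), N (pt j') (i (pt l')))"
      using i
    proof
      assume "i = \<iota>1"
      then show ?thesis
        using c_le d_le I Icd
        by (cases j; cases j'; cases l; cases l')
          (simp_all add: N_\<iota> snd_Y two_point_def four_point_def four_step_def min_le_iff_disj)
    next
      assume "i = \<iota>2"
      then show ?thesis
        using c_le d_le I Icd
        by (cases j; cases j'; cases l; cases l')
          (simp_all add: N_\<iota> snd_Y two_point_def four_point_def four_step_def min_le_iff_disj)
    qed
    finally show "snd (on_obj F W) (w, w') \<le> snd Y (composite (on_obj F W) f (on_mor F W Z i) w,
        composite (on_obj F W) f (on_mor F W Z i) w')"
      using val w jl by simp
  qed
  define f1 f2 where "f1 = composite (on_obj F W) f (on_mor F W Z \<iota>1)"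
    and "f2 = composite (on_obj F W) f (on_mor F W Z \<iota>2)"
  have f12: "f1 \<in> Hom C (on_obj F W) Y" "f2 \<in> Hom C (on_obj F W) Y"
    using f_\<iota> by (auto simp: f1_def f2_def)
  define h1 h2 where "h1 = \<phi> W f1" and "h2 = \<phi> W f2"
  have h12: "h1 \<in> Hom C W E" "h2 \<in> Hom C W E"
    using bij_betw_apply[OF bij[OF W]] f12 by (simp_all add: h1_def h2_def)

  \<comment> \<open>the transposes agree at the common point of the two halves of \<open>Z\<close>\<close>
  have glue: "h1 (pt True) = h2 (pt False)"
  proof -
    let ?e = "\<lambda>i. \<lambda>w\<in>{pt True}. pt i"
    have e: "?e i \<in> Hom C point W" for i
      by (rule const_Hom_C[OF W]) (simp add: W_def)
    have "composite (on_obj F point) f1 (on_mor F point W (?e True)) w =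
        composite (on_obj F point) f2 (on_mor F point W (?e False)) w" for w
    proof (cases "w \<in> fst (on_obj F point)")
      case True
      have q: "q point w = pt True"
        using Hom_C_D(4)[OF binary_product_Obj(3)[OF prod[OF point_Obj]] True] by (simp add: fst_point)
      have "composite (on_obj F point) (composite (on_obj F W) f (on_mor F W Z j))
          (on_mor F point W (?e i)) w = N (p point w) (j (pt i))"
        if j: "j \<in> Hom C W Z" for i j
      proof -
        let ?w = "on_mor F point W (?e i) w"
        have w': "?w \<in> fst (on_obj F W)" by (rule Hom_C_D(4)[OF F_mor[OF e] True])
        have "on_mor F W Z j ?w \<in> fst (on_obj F Z)" by (rule Hom_C_D(4)[OF F_mor[OF j] w'])
        then show ?thesis
          using True w' F_p[OF e True] F_q[OF e True] F_p[OF j w'] F_q[OF j w'] q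
          by (simp add: composite_def compose_def f_def)
      qed
      from this[OF \<iota>(1)] this[OF \<iota>(2)] show ?thesis
        by (simp add: f1_def f2_def \<iota>1_def \<iota>2_def)
    qed (simp add: composite_def compose_def)
    then have "composite (on_obj F point) f1 (on_mor F point W (?e True)) =
        composite (on_obj F point) f2 (on_mor F point W (?e False))" by (rule ext)
    then have "composite point h1 (?e True) = composite point h2 (?e False)"
      using nat_\<phi>[OF W point_Obj e f12(1), of True] nat_\<phi>[OF W point_Obj e f12(2), of False]
      by (simp add: h1_def h2_def)
    from fun_cong[OF this, of "pt True"] show ?thesis
      by (simp add: composite_def compose_def fst_point)
  qed

  define h where "h = (\<lambda>z\<in>fst Z. if z = g 0 then h1 (pt False) else if z = g 1 then h1 (pt True)
    else h2 (pt True))"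
  have E: "E \<in> Obj C" by (rule Hom_C_D(2)[OF h12(1)])
  have h_val: "h (g 0) = h1 (pt False)" "h (g 1) = h1 (pt True)" "h (g 2) = h2 (pt True)"
    using g_neq by (auto simp: h_def fst_Z)
  have pts: "pt i \<in> fst W" for i by (simp add: W_def)
  have hE: "h (g 0) \<in> fst E" "h (g 1) \<in> fst E" "h (g 2) \<in> fst E"
    unfolding h_val using Hom_C_D(4)[OF h12(1) pts] Hom_C_D(4)[OF h12(2) pts] by simp_all
  have h: "h \<in> Hom C Z E"
  proof (rule Hom_C_I[OF Z E])
    show "h \<in> fst Z \<rightarrow>\<^sub>E fst E"
      using hE by (auto simp: fst_Z h_def split: if_splits)
    have 01: "a \<le> snd E (h (g 0), h (g 1))" "b \<le> snd E (h (g 1), h (g 0))"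
      using Hom_C_D(5)[OF h12(1) pts pts, of False True] Hom_C_D(5)[OF h12(1) pts pts, of True False]
      unfolding h_val by (auto simp: W_def snd_pair_space two_point_def)
    have 12: "a \<le> snd E (h (g 1), h (g 2))" "b \<le> snd E (h (g 2), h (g 1))"
      using Hom_C_D(5)[OF h12(2) pts pts, of False True] Hom_C_D(5)[OF h12(2) pts pts, of True False]
      unfolding h_val glue by (auto simp: W_def snd_pair_space two_point_def)
    have "t a a \<le> t (snd E (h (g 1), h (g 2))) (snd E (h (g 0), h (g 1)))"
      using 01 12 I Obj_C_metric(1)[OF E] hE by (intro t_mono) auto
    then have 02: "t a a \<le> snd E (h (g 0), h (g 2))"
      using Obj_C_metric(4)[OF E hE] by linarith
    have "t b b \<le> t (snd E (h (g 1), h (g 0))) (snd E (h (g 2), h (g 1)))"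
      using 01 12 I Obj_C_metric(1)[OF E] hE by (intro t_mono) auto
    then have 20: "t b b \<le> snd E (h (g 2), h (g 0))"
      using Obj_C_metric(4)[OF E hE(3,2,1)] by linarith
    fix z z' assume "z \<in> fst Z" "z' \<in> fst Z"
    then show "snd Z (z, z') \<le> snd E (h z, h z')"
      using 01 12 02 20 Obj_C_metric(2)[OF E hE(1,1)] Obj_C_metric(2)[OF E hE(2,2)]
        Obj_C_metric(2)[OF E hE(3,3)]
      unfolding fst_Z by (auto simp: snd_Z three_point_def)
  qed
  have h_\<iota>: "composite W h \<iota>1 = h1" "composite W h \<iota>2 = h2"
  proof -
    have W_cases: "w = pt False \<or> w = pt True" if "w \<in> fst W" for w
      using that unfolding W_def by (auto, metis (full_types))
    have "composite W h \<iota>1 w = h1 w" "composite W h \<iota>2 w = h2 w" for w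
      using W_cases[of w] Hom_C_D(3)[OF h12(1)] Hom_C_D(3)[OF h12(2)] glue h_val
      by (auto simp: composite_def compose_def \<iota>1_def \<iota>2_def pts PiE_def extensional_def)
    then show "composite W h \<iota>1 = h1" "composite W h \<iota>2 = h2" by auto
  qed

  \<comment> \<open>transposing back shows that the quotient map is a morphism, at least at the two corners\<close>
  obtain f' where f': "f' \<in> Hom C (on_obj F Z) Y" "\<phi> Z f' = h"
  proof -
    have "h \<in> \<phi> Z ` Hom C (on_obj F Z) Y"
      using bij_betw_imp_surj_on[OF bij[OF Z]] h by simp
    then show ?thesis using that by blast
  qed
  have agree: "f' w = N (p Z w) (q Z w)"
    if j: "j = \<iota>1 \<or> j = \<iota>2" and w: "w \<in> fst (on_obj F Z)" and qw: "q Z w = j (pt l)" for w j l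
  proof -
    have jH: "j \<in> Hom C W Z" using j \<iota> by blast
    have "\<phi> W (composite (on_obj F W) f' (on_mor F W Z j)) =
        \<phi> W (composite (on_obj F W) f (on_mor F W Z j))"
      using nat_\<phi>[OF Z W jH f'(1)] h_\<iota> j f'(2) by (auto simp: h1_def h2_def f1_def f2_def)
    moreover have "composite (on_obj F W) f' (on_mor F W Z j) \<in> Hom C (on_obj F W) Y"
      using F_mor[OF jH] f'(1)
      by (auto simp: Hom_unit_Cat_S intro: unit_functors_composite split: if_splits)
    ultimately have eq: "composite (on_obj F W) f' (on_mor F W Z j) =
        composite (on_obj F W) f (on_mor F W Z j)"
      using inj_onD[OF bij_betw_imp_inj_on[OF bij[OF W]]] f_\<iota>[OF j] by blast
    have "p Z w \<in> fst X" using Hom_C_D(4)[OF binary_product_Obj(2)[OF prod[OF Z]] w] .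
    then obtain v where v: "v \<in> fst (on_obj F W)" "p W v = p Z w" "q W v = pt l"
      using product_point[OF prod[OF W] X W _ pts] by blast
    have "on_mor F W Z j v = w"
    proof (rule product_point_unique[OF prod[OF Z] X Z])
      show "on_mor F W Z j v \<in> fst (on_obj F Z)" by (rule Hom_C_D(4)[OF F_mor[OF jH] v(1)])
      show "p Z (on_mor F W Z j v) = p Z w" using F_p[OF jH v(1)] v(2) by simp
      show "q Z (on_mor F W Z j v) = q Z w" using F_q[OF jH v(1)] v(3) qw by simp
    qed (rule w)
    moreover have "f' (on_mor F W Z j v) = f (on_mor F W Z j v)"
      using fun_cong[OF eq, of v] v(1) by (simp add: composite_def compose_def)
    ultimately show ?thesis using w by (simp add: f_def)
  qed
  obtain w where w: "w \<in> fst (on_obj F Z)" "p Z w = pt False" "q Z w = g 0"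
    using product_point[OF prod[OF Z] X Z, of "pt False" "g 0"] by (auto simp: X_def fst_Z)
  obtain w' where w': "w' \<in> fst (on_obj F Z)" "p Z w' = pt True" "q Z w' = g 2"
    using product_point[OF prod[OF Z] X Z, of "pt True" "g 2"] by (auto simp: X_def fst_Z)
  have "f' w = k 0"
    using agree[of \<iota>1 w False] w N_\<iota>(1)[of False False] by (simp add: \<iota>1_def)
  moreover have "f' w' = k 3"
    using agree[of \<iota>2 w' True] w' N_\<iota>(2)[of True True] by (simp add: \<iota>2_def)
  moreover have "c \<le> snd (on_obj F Z) (w, w')"
    using product_dist[OF prod[OF Z] X Z w(1) w'(1)] w w'
    by (simp add: X_def snd_pair_space two_point_def snd_Z three_point_def c_def)
  ultimately have "c \<le> t c a"
    using Hom_C_D(5)[OF f'(1) w(1) w'(1)] by (simp add: snd_Y four_point_def four_step_def)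
  then have ca: "t c a = c" using t_le_left[OF Icd(1) I(1)] by simp
  have "t c c = t (t c a) a" using t_assoc[of c a a] Icd I by (simp add: c_def)
  then show ?thesis using ca I by (simp add: M_def idempotent_def c_def)
qed

theorem cartesian_closed_imp_subset_M:
  assumes "cartesian_closed C" shows "S \<subseteq> M t \<times> M t"
  using cartesian_closed_imp_in_M[OF assms] S_sym by auto

end

section \<open>Finite products\<close>

context suitable_enrichment
begin

text \<open>
  Products carry the pointwise minimum of the metrics, which has values in \<open>S\<close> because \<open>S\<close> is closed
  under meets; only the carrier, a set of functions, has to be renamed.
\<close>

lemma product_exists:
  fixes I :: "'i set"
  assumes I: "finite I" and F: "\<And>i. i \<in> I \<Longrightarrow> F i \<in> Obj C"
  shows "\<exists>P \<pi>. is_product C I F P \<pi>"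
proof -
  define Q where "Q = (\<Pi>\<^sub>E i\<in>I. fst (F i))"
  define D where "D h h' = meet I (\<lambda>i. snd (F i) (h i, h' i))" for h h'
  have "(\<Union>i\<in>I. fst (F i)) \<in> U"
  proof (cases "I = {}")
    case True
    then show ?thesis using subset_in_U[OF range_pt] by simp
  next
    case False
    then show ?thesis using finite_UN_in_U[OF I] F by (simp add: Obj_unit_Cat_S')
  qed
  then have "small U Q"
    unfolding Q_def by (intro small_PiE[OF small_finite[OF I] small_member]) auto
  then obtain g where g: "inj_on g Q" "g ` Q \<in> U" by (rule smallE)
  define P where "P = transport g Q D"
  define \<pi> where "\<pi> i = (\<lambda>w\<in>g ` Q. inv_into Q g w i)" for i
  have Q: "h i \<in> fst (F i)" if "h \<in> Q" "i \<in> I" for h i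
    using that by (auto simp: Q_def)
  have D: "S_metric t S Q D"
    unfolding D_def
  proof (rule S_metric_meet)
    fix i assume i: "i \<in> I"
    then have "S_metric t S (fst (F i)) (curry (snd (F i)))"
      using F by (simp add: Obj_unit_Cat_S')
    then show "S_metric t S Q (\<lambda>h h'. snd (F i) (h i, h' i))"
      using S_metric_pullback[of t S "fst (F i)" "curry (snd (F i))" "\<lambda>h. h i" Q] Q i by simp
  qed
  have P: "P \<in> Obj C" unfolding P_def by (rule transport_Obj[OF g D])
  have fst_P: "fst P = g ` Q" by (simp add: P_def)
  have snd_P: "snd P (g h, g h') = D h h'" if "h \<in> Q" "h' \<in> Q" for h h'
    unfolding P_def by (rule snd_transport[OF g(1) that])
  have \<pi>_g: "\<pi> i (g h) = h i" if "h \<in> Q" for i h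
    using g(1) that by (simp add: \<pi>_def)
  have D_iff: "c \<le> D h h' \<longleftrightarrow> c \<le> 1 \<and> (\<forall>i\<in>I. c \<le> snd (F i) (h i, h' i))"
    if "h \<in> Q" "h' \<in> Q" for c h h'
    unfolding D_def by (rule le_meet_iff) (use Obj_C_metric(1)[OF F] Q that in blast)
  have "is_product C I F P \<pi>"
    unfolding is_product_def
  proof (intro conjI ballI allI impI)
    show "P \<in> Obj C" by (rule P)
    fix i assume i: "i \<in> I"
    show "\<pi> i \<in> Hom C P (F i)"
    proof (rule Hom_C_I[OF P F[OF i]])
      show "\<pi> i \<in> fst P \<rightarrow>\<^sub>E fst (F i)"
        using Q i g(1) by (auto simp: fst_P \<pi>_def)
      fix w w' assume "w \<in> fst P" "w' \<in> fst P"
      then obtain h h' where h: "h \<in> Q" "h' \<in> Q" "w = g h" "w' = g h'" by (auto simp: fst_P)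
      then show "snd P (w, w') \<le> snd (F i) (\<pi> i w, \<pi> i w')"
        using D_iff[OF h(1,2), of "D h h'"] i by (simp add: snd_P \<pi>_g)
    qed
  next
    fix Z h assume Z: "Z \<in> Obj C" and h: "\<forall>i\<in>I. h i \<in> Hom C Z (F i)"
    have "h i z \<in> fst (F i)" if "i \<in> I" "z \<in> fst Z" for i z
      using Hom_C_D(4)[of "h i" Z "F i" z] h that by blast
    then have tup: "(\<lambda>i\<in>I. h i z) \<in> Q" if "z \<in> fst Z" for z
      using that by (simp add: Q_def)
    define m where "m = (\<lambda>z\<in>fst Z. g (\<lambda>i\<in>I. h i z))"
    have m: "m \<in> Hom C Z P"
    proof (rule Hom_C_I[OF Z P])
      show "m \<in> fst Z \<rightarrow>\<^sub>E fst P" using tup by (auto simp: m_def fst_P)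
      fix z z' assume z: "z \<in> fst Z" "z' \<in> fst Z"
      have "snd Z (z, z') \<le> 1" using Obj_C_metric(1)[OF Z z] by simp
      moreover have "snd Z (z, z') \<le> snd (F i) (h i z, h i z')" if "i \<in> I" for i
        using h that z by (blast intro: Hom_C_D(5))
      ultimately show "snd Z (z, z') \<le> snd P (m z, m z')"
        using z by (simp add: m_def snd_P[OF tup tup] D_iff[OF tup tup])
    qed
    have ext: "h i \<in> extensional (fst Z)" if "i \<in> I" for i
      using h that Hom_C_D(3)[of "h i" Z "F i"] by (simp add: PiE_def)
    have m\<pi>: "composite Z (\<pi> i) m = h i" if "i \<in> I" for i
      by (rule extensionalityI[of _ "fst Z"])
        (use that ext tup in \<open>auto simp: composite_def compose_def m_def \<pi>_g\<close>)
    show "\<exists>!m. m \<in> Hom C Z P \<and> (\<forall>i\<in>I. composite Z (\<pi> i) m = h i)"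
    proof (rule ex1I[of _ m])
      fix m' assume m': "m' \<in> Hom C Z P \<and> (\<forall>i\<in>I. composite Z (\<pi> i) m' = h i)"
      show "m' = m"
      proof (rule extensionalityI[of _ "fst Z"])
        show "m' \<in> extensional (fst Z)" using m' Hom_C_D(3)[of m' Z P] by (auto simp: PiE_def)
        show "m \<in> extensional (fst Z)" by (simp add: m_def)
        fix z assume z: "z \<in> fst Z"
        then have "m' z \<in> fst P" using m' Hom_C_D(4) by blast
        then obtain v where v: "v \<in> Q" "m' z = g v" by (auto simp: fst_P)
        have "v i = h i z" if "i \<in> I" for i
        proof -
          have "composite Z (\<pi> i) m' z = h i z" using m' that by simp
          then show ?thesis using z v by (simp add: composite_def compose_def \<pi>_g)
        qed
        then have "v = (\<lambda>i\<in>I. h i z)"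
          using v(1) tup[OF z] unfolding Q_def by (intro PiE_ext) auto
        then show "m' z = m z" using v(2) z by (simp add: m_def)
      qed
    qed (use m m\<pi> in blast)
  qed
  then show ?thesis by blast
qed

lemma binary_product_exists:
  assumes "X \<in> Obj C" "Z \<in> Obj C"
  shows "\<exists>P p q. is_binary_product C X Z P p q"
proof -
  have "\<exists>P \<pi>. is_product C UNIV (\<lambda>b. if b then X else Z) P \<pi>"
    by (rule product_exists) (use assms in auto)
  then obtain P \<pi> where "is_product C UNIV (\<lambda>b. if b then X else Z) P \<pi>"
    by blast
  moreover have "(\<lambda>b. if b then \<pi> True else \<pi> False) = \<pi>" by (auto simp: fun_eq_iff)
  ultimately have "is_binary_product C X Z P (\<pi> True) (\<pi> False)"
    by (simp add: is_binary_product_def)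
  then show ?thesis by blast
qed

lemma has_finite_products_C: "has_finite_products C"
  unfolding has_finite_products_def using product_exists by blast

end


section \<open>Function spaces\<close>

locale closed_enrichment = suitable_enrichment U t S for U :: "'u set set" and t S +
  assumes S_subset_M: "S \<subseteq> M t \<times> M t"
begin

text \<open>
  The distance of two morphisms is the largest one for which evaluation on the product with \<open>X\<close>, with
  its minimum metric, remains a morphism. It has to be maximized together with the opposite distance,
  since only pairs in \<open>S\<close> are permitted.
\<close>

definition nonexpansive_pair ::
  "'u set \<times> ('u \<times> 'u \<Rightarrow> real) \<Rightarrow> 'u set \<times> ('u \<times> 'u \<Rightarrow> real) \<Rightarrow> ('u \<Rightarrow> 'u) \<Rightarrow> ('u \<Rightarrow> 'u) \<Rightarrow> real \<Rightarrow> bool"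
where
  "nonexpansive_pair X Y f g a \<longleftrightarrow>
     (\<forall>x\<in>fst X. \<forall>x'\<in>fst X. min a (snd X (x, x')) \<le> snd Y (f x, g x'))"

definition power_pairs where
  "power_pairs X Y f g =
     {(a, b) \<in> S. nonexpansive_pair X Y f g a \<and> nonexpansive_pair X Y g f b}"

definition power_dist where
  "power_dist X Y f g = join (fst ` power_pairs X Y f g)"

lemma nonexpansive_pair_join:
  assumes X: "X \<in> Obj C" and f: "f \<in> Hom C X Y" and g: "g \<in> Hom C X Y" and T: "T \<subseteq> {0..1}"
    and ne: "\<And>a. a \<in> T \<Longrightarrow> nonexpansive_pair X Y f g a"
  shows "nonexpansive_pair X Y f g (join T)"
  unfolding nonexpansive_pair_def
proof (intro ballI)
  fix x x' assume x: "x \<in> fst X" "x' \<in> fst X"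
  have "0 \<le> snd Y (f x, g x')"
    using Obj_C_metric(1)[OF Hom_C_D(2)[OF f] Hom_C_D(4)[OF f x(1)] Hom_C_D(4)[OF g x(2)]] by simp
  then show "min (join T) (snd X (x, x')) \<le> snd Y (f x, g x')"
    using ne x by (intro min_join_le[OF T]) (auto simp: nonexpansive_pair_def)
qed

text \<open>
  The triangle inequality of function spaces. From \<open>f x\<close> to \<open>h x'\<close> one may pass through \<open>g x\<close>, moving
  the argument in the second step, or through \<open>g x'\<close>, moving it in the first. For distances in \<open>M t\<close>
  one of the two detours is short enough; outside \<open>M t\<close> both
  can fail.
\<close>

lemma nonexpansive_pair_t:
  assumes f: "f \<in> Hom C X Y" and g: "g \<in> Hom C X Y" and h: "h \<in> Hom C X Y"
    and a: "a \<in> M t" "nonexpansive_pair X Y f g a"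
    and a': "a' \<in> M t" "nonexpansive_pair X Y g h a'"
  shows "nonexpansive_pair X Y f h (t a' a)"
  unfolding nonexpansive_pair_def
proof (intro ballI)
  fix x x' assume x: "x \<in> fst X" "x' \<in> fst X"
  have X: "X \<in> Obj C" and Y: "Y \<in> Obj C" using Hom_C_D(1,2)[OF f] .
  let ?w = "snd X (x, x')" and ?s = "\<lambda>y y'. snd Y (y, y')"
  have fgh: "f x \<in> fst Y" "g x \<in> fst Y" "g x' \<in> fst Y" "h x' \<in> fst Y"
    using x f g h Hom_C_D(4) by blast+
  have I: "a \<in> {0..1}" "a' \<in> {0..1}" "?w \<in> {0..1}"
    using a(1) a'(1) Obj_C_metric(1)[OF X x] by (auto simp: M_def)
  have w: "?w \<in> M t" using Obj_C_metric(3)[OF X x] S_subset_M by auto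
  have diag: "b \<le> snd Y (u y, v y)" if "nonexpansive_pair X Y u v b" "b \<in> {0..1}" "y \<in> fst X"
    for u v b y
    using that Obj_C_metric(2)[OF X that(3,3)] by (auto simp: nonexpansive_pair_def dest!: bspec)
  have via_gx: "t (min a' ?w) a \<le> ?s (f x) (h x')"
  proof -
    have "t (min a' ?w) a \<le> t (?s (g x) (h x')) (?s (f x) (g x))"
      using a' x diag[OF a(2) I(1) x(1)] I Obj_C_metric(1)[OF Y] fgh
      by (intro t_mono) (auto simp: nonexpansive_pair_def)
    also have "\<dots> \<le> ?s (f x) (h x')" using Obj_C_metric(4)[OF Y] fgh by blast
    finally show ?thesis .
  qed
  have via_gx': "t a' (min a ?w) \<le> ?s (f x) (h x')"
  proof -
    have "t a' (min a ?w) \<le> t (?s (g x') (h x')) (?s (f x) (g x'))"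
      using a x diag[OF a'(2) I(2) x(2)] I Obj_C_metric(1)[OF Y] fgh
      by (intro t_mono) (auto simp: nonexpansive_pair_def)
    also have "\<dots> \<le> ?s (f x) (h x')" using Obj_C_metric(4)[OF Y] fgh by blast
    finally show ?thesis .
  qed
  show "min (t a' a) ?w \<le> ?s (f x) (h x')"
    using M_min_product_le[OF a'(1) a(1) w] via_gx via_gx' by linarith
qed

lemma power:
  assumes X: "X \<in> Obj C" and Y: "Y \<in> Obj C"
  shows "S_metric t S (Hom C X Y) (power_dist X Y)"
    and "\<And>f g. f \<in> Hom C X Y \<Longrightarrow> g \<in> Hom C X Y \<Longrightarrow>
      nonexpansive_pair X Y f g (power_dist X Y f g)"
    and "\<And>f g a b. f \<in> Hom C X Y \<Longrightarrow> g \<in> Hom C X Y \<Longrightarrow> (a, b) \<in> S \<Longrightarrow>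
      nonexpansive_pair X Y f g a \<Longrightarrow> nonexpansive_pair X Y g f b \<Longrightarrow> a \<le> power_dist X Y f g"
proof -
  let ?P = "power_pairs X Y"
  have sub: "?P f g \<subseteq> S" for f g by (auto simp: power_pairs_def)
  have sym: "(b, a) \<in> ?P g f" if "(a, b) \<in> ?P f g" for f g a b
    using that S_sym by (auto simp: power_pairs_def)
  have join: "(join (fst ` ?P f g), join (snd ` ?P f g)) \<in> ?P f g"
    if fg: "f \<in> Hom C X Y" "g \<in> Hom C X Y" for f g
  proof -
    have unit: "fst ` ?P f g \<subseteq> {0..1}" "snd ` ?P f g \<subseteq> {0..1}"
      using S_unit by (auto simp: power_pairs_def)
    have "nonexpansive_pair X Y f g (join (fst ` ?P f g))"
      by (rule nonexpansive_pair_join[OF X fg unit(1)]) (auto simp: power_pairs_def)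
    moreover have "nonexpansive_pair X Y g f (join (snd ` ?P f g))"
      by (rule nonexpansive_pair_join[OF X fg(2,1) unit(2)]) (auto simp: power_pairs_def)
    ultimately show ?thesis using S_Sup[OF sub[of f g]] by (simp add: power_pairs_def)
  qed
  have one: "(1, 1) \<in> ?P f f" if "f \<in> Hom C X Y" for f
    using S_one Hom_C_D(5)[OF that] by (auto simp: power_pairs_def nonexpansive_pair_def min_le_iff_disj)
  have tri: "(t a' a, t b' b) \<in> ?P f h"
    if fgh: "f \<in> Hom C X Y" "g \<in> Hom C X Y" "h \<in> Hom C X Y"
      and ab: "(a, b) \<in> ?P f g" "(a', b') \<in> ?P g h" for f g h a b a' b'
  proof -
    have M: "a \<in> M t" "b \<in> M t" "a' \<in> M t" "b' \<in> M t" and S: "(a, b) \<in> S" "(a', b') \<in> S"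
      using ab S_subset_M by (auto simp: power_pairs_def)
    have "nonexpansive_pair X Y f h (t a' a)" "nonexpansive_pair X Y h f (t b b')"
      using nonexpansive_pair_t[OF fgh] nonexpansive_pair_t[OF fgh(3,2,1)] M ab
      by (auto simp: power_pairs_def)
    moreover have "t b b' = t b' b" using t_comm M by (simp add: M_def)
    ultimately show ?thesis using S_t[OF S(2,1)] by (simp add: power_pairs_def)
  qed
  note J' = S_metric_join[of "Hom C X Y" ?P, OF sub sym join one tri]
  have J: "S_metric t S (Hom C X Y) (\<lambda>f g. join (fst ` ?P f g))"
    "\<And>f g. f \<in> Hom C X Y \<Longrightarrow> g \<in> Hom C X Y \<Longrightarrow>
      (join (fst ` ?P f g), join (fst ` ?P g f)) \<in> ?P f g"
    "\<And>f g a b. f \<in> Hom C X Y \<Longrightarrow> g \<in> Hom C X Y \<Longrightarrow> (a, b) \<in> ?P f g \<Longrightarrow>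
      a \<le> join (fst ` ?P f g)"
    by (rule J'; assumption)+
  show "S_metric t S (Hom C X Y) (power_dist X Y)"
    using J(1) by (simp add: power_dist_def[abs_def])
  show "nonexpansive_pair X Y f g (power_dist X Y f g)"
    if "f \<in> Hom C X Y" "g \<in> Hom C X Y" for f g
    using J(2)[OF that] by (simp add: power_dist_def power_pairs_def)
  show "a \<le> power_dist X Y f g"
    if "f \<in> Hom C X Y" "g \<in> Hom C X Y" "(a, b) \<in> S"
      "nonexpansive_pair X Y f g a" "nonexpansive_pair X Y g f b" for f g a b
    using J(3)[OF that(1,2), of a b] that(3-) by (simp add: power_dist_def power_pairs_def)
qed

lemma small_Hom:
  assumes "X \<in> Obj C" "Y \<in> Obj C" shows "small U (Hom C X Y)"
proof (rule small_subset)
  show "small U (fst X \<rightarrow>\<^sub>E fst Y)"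
    using assms by (intro small_PiE[of _ "fst Y"] small_member) (auto simp: Obj_unit_Cat_S')
qed (use Hom_C_D(3) in blast)

end

section \<open>The adjunction\<close>

text \<open>
  Products of \<open>X\<close> with arbitrary objects are used through their points and distances only, so any
  choice of them will do.
\<close>

context closed_enrichment
begin

context
  fixes X P p q
  assumes X: "X \<in> Obj C"
    and prod: "\<And>Z. Z \<in> Obj C \<Longrightarrow> is_binary_product C X Z (P Z) (p Z) (q Z)"
begin

lemma P_eqI:
  assumes "Z \<in> Obj C" "w \<in> fst (P Z)" "w' \<in> fst (P Z)" "p Z w = p Z w'" "q Z w = q Z w'"
  shows "w = w'"
  by (rule product_point_unique[OF prod[OF assms(1)] X assms])

definition pair :: "'u set \<times> ('u \<times> 'u \<Rightarrow> real) \<Rightarrow> 'u \<Rightarrow> 'u \<Rightarrow> 'u" where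
  "pair Z x z = (THE w. w \<in> fst (P Z) \<and> p Z w = x \<and> q Z w = z)"

lemma pair:
  assumes "Z \<in> Obj C" "x \<in> fst X" "z \<in> fst Z"
  shows "pair Z x z \<in> fst (P Z)" "p Z (pair Z x z) = x" "q Z (pair Z x z) = z"
proof -
  obtain w where w: "w \<in> fst (P Z)" "p Z w = x" "q Z w = z"
    by (rule product_point[OF prod[OF assms(1)] X assms])
  have "\<exists>!w. w \<in> fst (P Z) \<and> p Z w = x \<and> q Z w = z"
  proof (rule ex1I[of _ w])
    show "w' = w" if "w' \<in> fst (P Z) \<and> p Z w' = x \<and> q Z w' = z" for w'
      by (rule P_eqI[OF assms(1)]) (use w that in simp_all)
  qed (use w in simp)
  then have "pair Z x z \<in> fst (P Z) \<and> p Z (pair Z x z) = x \<and> q Z (pair Z x z) = z"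
    unfolding pair_def by (rule theI')
  then show "pair Z x z \<in> fst (P Z)" "p Z (pair Z x z) = x" "q Z (pair Z x z) = z"
    by blast+
qed

lemma P_Obj: "Z \<in> Obj C \<Longrightarrow> P Z \<in> Obj C"
  by (rule binary_product_Obj(1)[OF prod])

lemma pq_in:
  assumes "Z \<in> Obj C" "w \<in> fst (P Z)"
  shows "p Z w \<in> fst X" "q Z w \<in> fst Z"
  by (rule Hom_C_D(4)[OF _ assms(2)], rule binary_product_Obj(2,3)[OF prod[OF assms(1)]])+

lemma pair_eta:
  assumes Z: "Z \<in> Obj C" and w: "w \<in> fst (P Z)"
  shows "pair Z (p Z w) (q Z w) = w"
  by (rule P_eqI[OF Z]) (use pair[OF Z pq_in[OF Z w]] w in simp_all)

lemma P_dist: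
  assumes "Z \<in> Obj C" "w \<in> fst (P Z)" "w' \<in> fst (P Z)"
  shows "snd (P Z) (w, w') = min (snd X (p Z w, p Z w')) (snd Z (q Z w, q Z w'))"
proof (rule antisym)
  show "snd (P Z) (w, w') \<le> min (snd X (p Z w, p Z w')) (snd Z (q Z w, q Z w'))"
    using binary_product_Obj(2,3)[OF prod[OF assms(1)]] assms(2,3) by (simp add: Hom_C_D(5))
qed (rule product_dist[OF prod[OF assms(1)] X assms])

definition product_functor :: "('u, 'u \<times> 'u \<Rightarrow> real) cfunctor" where
  "product_functor = \<lparr>on_obj = P, on_mor = (\<lambda>V V' f. \<lambda>w\<in>fst (P V). pair V' (p V w) (f (q V w)))\<rparr>"

lemma product_functor_mor:
  assumes f: "f \<in> Hom C V V'" and w: "w \<in> fst (P V)"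
  shows "on_mor product_functor V V' f w \<in> fst (P V')"
    "p V' (on_mor product_functor V V' f w) = p V w" "q V' (on_mor product_functor V V' f w) = f (q V w)"
  using pair[OF Hom_C_D(2)[OF f] pq_in(1)[OF Hom_C_D(1)[OF f] w]
      Hom_C_D(4)[OF f pq_in(2)[OF Hom_C_D(1)[OF f] w]]] w
  by (simp_all add: product_functor_def)

lemma product_functor_mor_pair:
  assumes f: "f \<in> Hom C V V'" and "x \<in> fst X" "v \<in> fst V"
  shows "on_mor product_functor V V' f (pair V x v) = pair V' x (f v)"
  using pair[OF Hom_C_D(1)[OF f] assms(2,3)] by (simp add: product_functor_def)

lemma product_functor_mor_Hom:
  assumes f: "f \<in> Hom C V V'" shows "on_mor product_functor V V' f \<in> Hom C (P V) (P V')"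
proof (rule Hom_C_I)
  have V: "V \<in> Obj C" "V' \<in> Obj C" using f Hom_C_D by blast+
  show "P V \<in> Obj C" "P V' \<in> Obj C" using V P_Obj by auto
  show "on_mor product_functor V V' f \<in> fst (P V) \<rightarrow>\<^sub>E fst (P V')"
    using product_functor_mor(1)[OF f] by (intro PiE_I) (simp_all add: product_functor_def)
  fix w w' assume w: "w \<in> fst (P V)" "w' \<in> fst (P V)"
  have "snd V (q V w, q V w') \<le> snd V' (f (q V w), f (q V w'))"
    using Hom_C_D(5)[OF f] pq_in(2)[OF V(1)] w by blast
  then show "snd (P V) (w, w') \<le> snd (P V') (on_mor product_functor V V' f w, on_mor product_functor V V' f w')"
    using w product_functor_mor[OF f] by (simp add: P_dist[OF V(1)] P_dist[OF V(2)] min_le_iff_disj)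
qed

lemma composite_Hom: "f \<in> Hom C V V' \<Longrightarrow> g \<in> Hom C V' V'' \<Longrightarrow> composite V g f \<in> Hom C V V''"
  using is_construct_unit_Cat_S[of U t S] Hom_C_D(1,2) unfolding is_construct_def by blast

lemma composite_apply: "v \<in> fst V \<Longrightarrow> composite V g f v = g (f v)"
  by (simp add: composite_def compose_def)

lemma product_functor_is_functor: "is_functor C C product_functor"
  unfolding is_functor_def
proof (intro conjI ballI)
  fix V assume V: "V \<in> Obj C"
  then show "on_obj product_functor V \<in> Obj C" by (simp add: product_functor_def P_Obj)
  show "on_mor product_functor V V (ident V) = ident (on_obj product_functor V)"
    by (rule ext) (use V pq_in pair_eta in \<open>auto simp: product_functor_def ident_def\<close>)
  fix V' f assume V': "V' \<in> Obj C" and f: "f \<in> Hom C V V'"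
  then show "on_mor product_functor V V' f \<in> Hom C (on_obj product_functor V) (on_obj product_functor V')"
    using product_functor_mor_Hom by (simp add: product_functor_def)
  fix V'' g assume V'': "V'' \<in> Obj C" and g: "g \<in> Hom C V' V''"
  show "on_mor product_functor V V'' (composite V g f) =
      composite (on_obj product_functor V) (on_mor product_functor V' V'' g) (on_mor product_functor V V' f)"
  proof (rule extensionalityI[of _ "fst (P V)"])
    fix w assume w: "w \<in> fst (P V)"
    show "on_mor product_functor V V'' (composite V g f) w =
        composite (on_obj product_functor V) (on_mor product_functor V' V'' g) (on_mor product_functor V V' f) w"
    proof (rule P_eqI[OF V''])
      note gf = product_functor_mor[OF composite_Hom[OF f g] w]
        and fw = product_functor_mor[OF f w] and gfw = product_functor_mor[OF g product_functor_mor(1)[OF f w]]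
      have *: "composite (on_obj product_functor V) (on_mor product_functor V' V'' g) (on_mor product_functor V V' f) w =
          on_mor product_functor V' V'' g (on_mor product_functor V V' f w)"
        using w by (simp add: composite_apply product_functor_def)
      show "on_mor product_functor V V'' (composite V g f) w \<in> fst (P V'')" by (rule gf(1))
      show "composite (on_obj product_functor V) (on_mor product_functor V' V'' g) (on_mor product_functor V V' f) w \<in> fst (P V'')"
        unfolding * by (rule gfw(1))
      show "p V'' (on_mor product_functor V V'' (composite V g f) w) =
          p V'' (composite (on_obj product_functor V) (on_mor product_functor V' V'' g) (on_mor product_functor V V' f) w)"
        unfolding * gf gfw fw ..
      show "q V'' (on_mor product_functor V V'' (composite V g f) w) =
          q V'' (composite (on_obj product_functor V) (on_mor product_functor V' V'' g) (on_mor product_functor V V' f) w)"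
        unfolding * gf gfw fw by (rule composite_apply[OF pq_in(2)[OF V w]])
    qed
  qed (simp_all add: product_functor_def composite_def)
qed

lemma product_functor_is_product_functor: "is_product_functor C X product_functor"
  unfolding is_product_functor_def
proof (intro conjI exI ballI)
  show "is_functor C C product_functor" by (rule product_functor_is_functor)
  fix V assume V: "V \<in> Obj C"
  then show "is_binary_product C X V (on_obj product_functor V) (p V) (q V)"
    using prod by (simp add: product_functor_def)
  fix V' f assume "V' \<in> Obj C" and f: "f \<in> Hom C V V'"
  have pV: "p V \<in> fst (P V) \<rightarrow>\<^sub>E fst X"
    using Hom_C_D(3) binary_product_Obj(2)[OF prod[OF V]] by blast
  show "composite (on_obj product_functor V) (p V') (on_mor product_functor V V' f) = p V"
    by (rule extensionalityI[of _ "fst (P V)"])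
      (use product_functor_mor[OF f] pV in \<open>auto simp: composite_def compose_def product_functor_def PiE_def\<close>)
  show "composite (on_obj product_functor V) (q V') (on_mor product_functor V V' f) = composite (on_obj product_functor V) f (q V)"
    by (rule extensionalityI[of _ "fst (P V)"])
      (use product_functor_mor[OF f] in \<open>auto simp: composite_def compose_def product_functor_def\<close>)
qed

text \<open>
  The points of the power object are the morphisms themselves, renamed into the universe along some
  injection.
\<close>

definition encode :: "'u set \<times> ('u \<times> 'u \<Rightarrow> real) \<Rightarrow> ('u \<Rightarrow> 'u) \<Rightarrow> 'u" where
  "encode Y = (SOME g. inj_on g (Hom C X Y) \<and> g ` Hom C X Y \<in> U)"

definition decode :: "'u set \<times> ('u \<times> 'u \<Rightarrow> real) \<Rightarrow> 'u \<Rightarrow> 'u \<Rightarrow> 'u" where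
  "decode Y = inv_into (Hom C X Y) (encode Y)"

definition power_obj :: "'u set \<times> ('u \<times> 'u \<Rightarrow> real) \<Rightarrow> 'u set \<times> ('u \<times> 'u \<Rightarrow> real)" where
  "power_obj Y = transport (encode Y) (Hom C X Y) (power_dist X Y)"

definition power_functor :: "('u, 'u \<times> 'u \<Rightarrow> real) cfunctor" where
  "power_functor = \<lparr>on_obj = power_obj,
     on_mor = (\<lambda>Y Y' k. \<lambda>e\<in>fst (power_obj Y). encode Y' (composite X k (decode Y e)))\<rparr>"

lemma encode:
  assumes "Y \<in> Obj C" shows "inj_on (encode Y) (Hom C X Y)" "encode Y ` Hom C X Y \<in> U"
proof -
  have "\<exists>g :: ('u \<Rightarrow> 'u) \<Rightarrow> 'u. inj_on g (Hom C X Y) \<and> g ` Hom C X Y \<in> U"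
    using smallE[OF small_Hom[OF X assms]] by blast
  then have "inj_on (encode Y) (Hom C X Y) \<and> encode Y ` Hom C X Y \<in> U"
    unfolding encode_def by (rule someI_ex)
  then show "inj_on (encode Y) (Hom C X Y)" "encode Y ` Hom C X Y \<in> U" by auto
qed

lemma fst_power_obj: "fst (power_obj Y) = encode Y ` Hom C X Y"
  by (simp add: power_obj_def)

lemma decode_encode [simp]: "f \<in> Hom C X Y \<Longrightarrow> decode Y (encode Y f) = f"
  unfolding decode_def using encode(1)[OF Hom_C_D(2)] by (simp add: inv_into_f_f)

lemma decode_Hom: "e \<in> fst (power_obj Y) \<Longrightarrow> decode Y e \<in> Hom C X Y"
  by (auto simp: fst_power_obj)

lemma encode_decode: "e \<in> fst (power_obj Y) \<Longrightarrow> encode Y (decode Y e) = e"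
  by (auto simp: fst_power_obj)

lemma power_obj_Obj: "Y \<in> Obj C \<Longrightarrow> power_obj Y \<in> Obj C"
  unfolding power_obj_def by (intro transport_Obj encode power X)

lemma snd_power_obj:
  assumes "f \<in> Hom C X Y" "g \<in> Hom C X Y"
  shows "snd (power_obj Y) (encode Y f, encode Y g) = power_dist X Y f g"
  unfolding power_obj_def by (rule snd_transport[OF encode(1)[OF Hom_C_D(2)[OF assms(1)]] assms])

lemma nonexpansive_pair_comp:
  assumes k: "k \<in> Hom C Y Y'" and f: "f \<in> Hom C X Y" and g: "g \<in> Hom C X Y"
    and ne: "nonexpansive_pair X Y f g a"
  shows "nonexpansive_pair X Y' (composite X k f) (composite X k g) a"
  unfolding nonexpansive_pair_def
proof (intro ballI)
  fix x x' assume x: "x \<in> fst X" "x' \<in> fst X"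
  have "min a (snd X (x, x')) \<le> snd Y (f x, g x')"
    using ne x by (simp add: nonexpansive_pair_def)
  also have "\<dots> \<le> snd Y' (k (f x), k (g x'))"
    by (rule Hom_C_D(5)[OF k Hom_C_D(4)[OF f x(1)] Hom_C_D(4)[OF g x(2)]])
  finally show "min a (snd X (x, x')) \<le> snd Y' (composite X k f x, composite X k g x')"
    using x by (simp add: composite_apply)
qed

lemma power_pair_in_S:
  assumes "f \<in> Hom C X Y" "g \<in> Hom C X Y"
  shows "(power_dist X Y f g, power_dist X Y g f) \<in> S"
  using power(1)[OF X Hom_C_D(2)[OF assms(1)]] assms by (auto simp: S_metric_def)

lemma power_mor_Hom:
  assumes k: "k \<in> Hom C Y Y'"
  shows "on_mor power_functor Y Y' k \<in> Hom C (power_obj Y) (power_obj Y')"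
proof (rule Hom_C_I)
  have Y: "Y \<in> Obj C" "Y' \<in> Obj C" using k Hom_C_D by blast+
  show "power_obj Y \<in> Obj C" "power_obj Y' \<in> Obj C" using Y power_obj_Obj by auto
  show "on_mor power_functor Y Y' k \<in> fst (power_obj Y) \<rightarrow>\<^sub>E fst (power_obj Y')"
    using composite_Hom[OF decode_Hom k] by (intro PiE_I) (auto simp: power_functor_def fst_power_obj)
  fix e e' assume "e \<in> fst (power_obj Y)" "e' \<in> fst (power_obj Y)"
  then obtain f g where fg: "f \<in> Hom C X Y" "g \<in> Hom C X Y" "e = encode Y f" "e' = encode Y g"
    by (auto simp: fst_power_obj)
  have "power_dist X Y f g \<le> power_dist X Y' (composite X k f) (composite X k g)"
    using power(3)[OF X Y(2) composite_Hom[OF fg(1) k] composite_Hom[OF fg(2) k] power_pair_in_S[OF fg(1,2)]]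
      nonexpansive_pair_comp[OF k] power(2)[OF X Y(1)] fg by blast
  then show "snd (power_obj Y) (e, e') \<le>
      snd (power_obj Y') (on_mor power_functor Y Y' k e, on_mor power_functor Y Y' k e')"
    using fg composite_Hom[OF fg(1) k] composite_Hom[OF fg(2) k]
    by (simp add: power_functor_def fst_power_obj snd_power_obj)
qed

lemma power_is_functor: "is_functor C C power_functor"
  unfolding is_functor_def
proof (intro conjI ballI)
  fix Y assume Y: "Y \<in> Obj C"
  then show "on_obj power_functor Y \<in> Obj C" by (simp add: power_functor_def power_obj_Obj)
  have id: "composite X (ident Y) f = f" if "f \<in> Hom C X Y" for f
    by (rule composite_ident_left[OF Hom_C_D(3)[OF that]])
  show "on_mor power_functor Y Y (ident Y) = ident (on_obj power_functor Y)"
    by (rule ext) (auto simp: power_functor_def ident_def fst_power_obj id[unfolded ident_def])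
  fix Y' k assume Y': "Y' \<in> Obj C" and k: "k \<in> Hom C Y Y'"
  then show "on_mor power_functor Y Y' k \<in> Hom C (on_obj power_functor Y) (on_obj power_functor Y')"
    using power_mor_Hom by (simp add: power_functor_def)
  fix Y'' l assume Y'': "Y'' \<in> Obj C" and l: "l \<in> Hom C Y' Y''"
  have assoc: "composite X (composite Y l k) f = composite X l (composite X k f)"
    if "f \<in> Hom C X Y" for f
    by (rule ext) (use Hom_C_D(4)[OF that] in \<open>auto simp: composite_def compose_def\<close>)
  show "on_mor power_functor Y Y'' (composite Y l k) =
      composite (on_obj power_functor Y) (on_mor power_functor Y' Y'' l) (on_mor power_functor Y Y' k)"
  proof (rule extensionalityI[of _ "fst (power_obj Y)"])
    fix e assume e: "e \<in> fst (power_obj Y)"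
    then obtain f where f: "f \<in> Hom C X Y" "e = encode Y f" by (auto simp: fst_power_obj)
    show "on_mor power_functor Y Y'' (composite Y l k) e =
        composite (on_obj power_functor Y) (on_mor power_functor Y' Y'' l)
          (on_mor power_functor Y Y' k) e"
      using f composite_Hom[OF f(1) k]
      by (simp add: power_functor_def composite_apply fst_power_obj assoc)
  qed (simp_all add: power_functor_def composite_def)
qed

definition curried :: "'u set \<times> ('u \<times> 'u \<Rightarrow> real) \<Rightarrow> ('u \<Rightarrow> 'u) \<Rightarrow> 'u \<Rightarrow> 'u \<Rightarrow> 'u" where
  "curried V f v = (\<lambda>x\<in>fst X. f (pair V x v))"

definition to_power where
  "to_power V Y f = (\<lambda>v\<in>fst V. encode Y (curried V f v))"

definition from_power where
  "from_power V Y h = (\<lambda>w\<in>fst (P V). decode Y (h (q V w)) (p V w))"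

lemma curried_Hom:
  assumes V: "V \<in> Obj C" and f: "f \<in> Hom C (P V) Y" and v: "v \<in> fst V"
  shows "curried V f v \<in> Hom C X Y"
proof (rule Hom_C_I[OF X Hom_C_D(2)[OF f]])
  show "curried V f v \<in> fst X \<rightarrow>\<^sub>E fst Y"
    using Hom_C_D(4)[OF f] pair(1)[OF V _ v] by (auto simp: curried_def)
  fix x x' assume x: "x \<in> fst X" "x' \<in> fst X"
  have "snd X (x, x') \<le> snd (P V) (pair V x v, pair V x' v)"
    using pair[OF V x(1) v] pair[OF V x(2) v] Obj_C_metric(2)[OF V v v] Obj_C_metric(1)[OF X x]
    by (simp add: P_dist[OF V])
  also have "\<dots> \<le> snd Y (f (pair V x v), f (pair V x' v))"
    by (rule Hom_C_D(5)[OF f pair(1)[OF V x(1) v] pair(1)[OF V x(2) v]])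
  finally show "snd X (x, x') \<le> snd Y (curried V f v x, curried V f v x')"
    using x by (simp add: curried_def)
qed

lemma curried_nonexpansive:
  assumes V: "V \<in> Obj C" and f: "f \<in> Hom C (P V) Y" and v: "v \<in> fst V" "v' \<in> fst V"
  shows "nonexpansive_pair X Y (curried V f v) (curried V f v') (snd V (v, v'))"
  unfolding nonexpansive_pair_def
proof (intro ballI)
  fix x x' assume x: "x \<in> fst X" "x' \<in> fst X"
  note w = pair[OF V x(1) v(1)] and w' = pair[OF V x(2) v(2)]
  show "min (snd V (v, v')) (snd X (x, x')) \<le> snd Y (curried V f v x, curried V f v' x')"
    using Hom_C_D(5)[OF f w(1) w'(1)] w w' x
    by (simp add: P_dist[OF V] curried_def min.commute)
qed

lemma to_power_Hom:
  assumes V: "V \<in> Obj C" and f: "f \<in> Hom C (P V) Y"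
  shows "to_power V Y f \<in> Hom C V (power_obj Y)"
proof (rule Hom_C_I[OF V power_obj_Obj[OF Hom_C_D(2)[OF f]]])
  show "to_power V Y f \<in> fst V \<rightarrow>\<^sub>E fst (power_obj Y)"
    using curried_Hom[OF V f] by (auto simp: to_power_def fst_power_obj)
  fix v v' assume v: "v \<in> fst V" "v' \<in> fst V"
  have "snd V (v, v') \<le> power_dist X Y (curried V f v) (curried V f v')"
    by (rule power(3)[OF X Hom_C_D(2)[OF f] curried_Hom[OF V f v(1)] curried_Hom[OF V f v(2)]
          Obj_C_metric(3)[OF V v] curried_nonexpansive[OF V f v] curried_nonexpansive[OF V f v(2,1)]])
  then show "snd V (v, v') \<le> snd (power_obj Y) (to_power V Y f v, to_power V Y f v')"
    using v curried_Hom[OF V f] by (simp add: to_power_def snd_power_obj)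
qed

lemma from_power_Hom:
  assumes Y: "Y \<in> Obj C" and h: "h \<in> Hom C V (power_obj Y)"
  shows "from_power V Y h \<in> Hom C (P V) Y"
proof -
  have V: "V \<in> Obj C" using h Hom_C_D by blast
  have dec: "decode Y (h v) \<in> Hom C X Y" if "v \<in> fst V" for v
    by (rule decode_Hom[OF Hom_C_D(4)[OF h that]])
  show ?thesis
  proof (rule Hom_C_I[OF P_Obj[OF V] Y])
    show "from_power V Y h \<in> fst (P V) \<rightarrow>\<^sub>E fst Y"
      using Hom_C_D(4)[OF dec] pq_in[OF V] by (auto simp: from_power_def)
    fix w w' assume w: "w \<in> fst (P V)" "w' \<in> fst (P V)"
    let ?f = "decode Y (h (q V w))" and ?g = "decode Y (h (q V w'))"
    note pq = pq_in[OF V w(1)] pq_in[OF V w(2)]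
    have "snd V (q V w, q V w') \<le> snd (power_obj Y) (encode Y ?f, encode Y ?g)"
      using Hom_C_D(5)[OF h pq(2,4)] Hom_C_D(4)[OF h] pq by (simp add: encode_decode)
    also have "\<dots> = power_dist X Y ?f ?g" by (rule snd_power_obj[OF dec[OF pq(2)] dec[OF pq(4)]])
    finally have "snd (P V) (w, w') \<le> min (power_dist X Y ?f ?g) (snd X (p V w, p V w'))"
      using w by (simp add: P_dist[OF V] min_le_iff_disj)
    also have "\<dots> \<le> snd Y (?f (p V w), ?g (p V w'))"
      using power(2)[OF X Y dec[OF pq(2)] dec[OF pq(4)]] pq by (simp add: nonexpansive_pair_def)
    finally show "snd (P V) (w, w') \<le> snd Y (from_power V Y h w, from_power V Y h w')"
      using w by (simp add: from_power_def)
  qed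
qed

lemma from_power_to_power:
  assumes V: "V \<in> Obj C" and f: "f \<in> Hom C (P V) Y"
  shows "from_power V Y (to_power V Y f) = f"
proof (rule extensionalityI[of _ "fst (P V)"])
  show "f \<in> extensional (fst (P V))" using Hom_C_D(3)[OF f] by (simp add: PiE_def)
  fix w assume w: "w \<in> fst (P V)"
  then show "from_power V Y (to_power V Y f) w = f w"
    using pq_in[OF V w] curried_Hom[OF V f] pair_eta[OF V w]
    by (simp add: from_power_def to_power_def) (simp add: curried_def)
qed (simp add: from_power_def)

lemma to_power_from_power:
  assumes Y: "Y \<in> Obj C" and h: "h \<in> Hom C V (power_obj Y)"
  shows "to_power V Y (from_power V Y h) = h"
proof (rule extensionalityI[of _ "fst V"])
  have V: "V \<in> Obj C" using h Hom_C_D by blast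
  show "h \<in> extensional (fst V)" using Hom_C_D(3)[OF h] by (simp add: PiE_def)
  fix v assume v: "v \<in> fst V"
  have dec: "decode Y (h v) \<in> Hom C X Y" by (rule decode_Hom[OF Hom_C_D(4)[OF h v]])
  have "curried V (from_power V Y h) v = decode Y (h v)"
  proof (rule extensionalityI[of _ "fst X"])
    show "decode Y (h v) \<in> extensional (fst X)" using Hom_C_D(3)[OF dec] by (simp add: PiE_def)
    fix x assume x: "x \<in> fst X"
    then show "curried V (from_power V Y h) v x = decode Y (h v) x"
      using pair[OF V x v] by (simp add: curried_def from_power_def)
  qed (simp add: curried_def)
  then show "to_power V Y (from_power V Y h) v = h v"
    using v encode_decode[OF Hom_C_D(4)[OF h v]] by (simp add: to_power_def)
qed (simp add: to_power_def)

lemma right_adjoint_power: "right_adjoint C C product_functor power_functor"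
  unfolding right_adjoint_def
proof (intro conjI exI[of _ to_power] ballI)
  show "is_functor C C product_functor" "is_functor C C power_functor"
    by (rule product_functor_is_functor, rule power_is_functor)
  have obj: "on_obj product_functor = P" "on_obj power_functor = power_obj"
    by (simp_all add: product_functor_def power_functor_def)
  fix V Y assume V: "V \<in> Obj C" and Y: "Y \<in> Obj C"
  show "bij_betw (to_power V Y) (Hom C (on_obj product_functor V) Y) (Hom C V (on_obj power_functor Y))"
    unfolding obj
    by (rule bij_betw_byWitness[of _ "from_power V Y"])
      (use from_power_to_power[OF V] to_power_from_power[OF Y] to_power_Hom[OF V]
        from_power_Hom[OF Y] in \<open>simp_all add: image_subset_iff\<close>)
next
  have obj: "on_obj product_functor = P" "on_obj power_functor = power_obj"
    by (simp_all add: product_functor_def power_functor_def)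
  fix V V' Y h f
  assume V: "V \<in> Obj C" "V' \<in> Obj C" and Y: "Y \<in> Obj C" and h: "h \<in> Hom C V' V"
    and f: "f \<in> Hom C (on_obj product_functor V) Y"
  have "curried V' (composite (P V') f (on_mor product_functor V' V h)) v = curried V f (h v)"
    if v: "v \<in> fst V'" for v
    unfolding curried_def
  proof (rule restrict_ext)
    fix x assume x: "x \<in> fst X"
    show "composite (P V') f (on_mor product_functor V' V h) (pair V' x v) = f (pair V x (h v))"
      using composite_apply[OF pair(1)[OF V(2) x v]] product_functor_mor_pair[OF h x v] by simp
  qed
  then show "to_power V' Y (composite (on_obj product_functor V') f (on_mor product_functor V' V h)) =
      composite V' (to_power V Y f) h"
    unfolding obj using Hom_C_D(4)[OF h]
    by (auto simp: to_power_def composite_def[of V'] compose_def)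
next
  have obj: "on_obj product_functor = P" "on_obj power_functor = power_obj"
    by (simp_all add: product_functor_def power_functor_def)
  fix V Y Y' k f
  assume V: "V \<in> Obj C" and Y: "Y \<in> Obj C" "Y' \<in> Obj C" and k: "k \<in> Hom C Y Y'"
    and f: "f \<in> Hom C (on_obj product_functor V) Y"
  then have f': "f \<in> Hom C (P V) Y" by (simp add: obj)
  have "curried V (composite (P V) k f) v = composite X k (curried V f v)" if v: "v \<in> fst V" for v
    using pair(1)[OF V _ v]
    by (auto simp: curried_def composite_def compose_def)
  then show "to_power V Y' (composite (on_obj product_functor V) k f) =
      composite V (on_mor power_functor Y Y' k) (to_power V Y f)"
    unfolding obj using curried_Hom[OF V f']
    by (auto simp: to_power_def composite_def[of V] compose_def power_functor_def fst_power_obj)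
qed

end

theorem cartesian_closed_C: "cartesian_closed C"
  unfolding cartesian_closed_def
proof (intro conjI ballI)
  show "has_finite_products C" by (rule has_finite_products_C)
  fix X assume X: "X \<in> Obj C"
  obtain P p q where "\<And>Z. Z \<in> Obj C \<Longrightarrow> is_binary_product C X Z (P Z) (p Z) (q Z)"
    using binary_product_exists[OF X] by metis
  from product_functor_is_product_functor[OF X this] right_adjoint_power[OF X this]
  show "\<exists>F. is_product_functor C X F \<and> (\<exists>G. right_adjoint C C F G)" by blast
qed

end


section \<open>The characterization\<close>

text \<open>
  Closure under joins and meets is topological closedness of \<open>M t\<close>, together with \<open>0\<close> and \<open>1\<close> for
  the empty ones.
\<close>

lemma (in t_norm) suitable_M: "suitable t (M t \<times> M t)"
proof -
  have unit: "M t \<subseteq> {0..1}" by (auto simp: M_def)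
  have Sup: "Sup (insert 0 A) \<in> M t" if "A \<subseteq> M t" for A
    using that unit zero_in_M
    by (intro closed_subset_contains_Sup[OF closed_M] bdd_aboveI[of _ 1]) auto
  have Inf: "Inf (insert 1 A) \<in> M t" if "A \<subseteq> M t" for A
    using that unit one_in_M
    by (intro closed_subset_contains_Inf[OF closed_M] bdd_belowI[of _ 0]) auto
  have "fst ` T \<subseteq> M t" "snd ` T \<subseteq> M t" if "T \<subseteq> M t \<times> M t" for T
    using that by auto
  then show ?thesis
    unfolding suitable_def using unit Sup Inf M_t_closed by auto
qed

lemma M_Cat_eq: "M_Cat U t = unit_Cat_S U t (M t \<times> M t)"
proof -
  have "(\<lambda>(X :: 'a set, r). \<forall>x\<in>X. \<forall>y\<in>X. r (x, y) \<in> M t) =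
      (\<lambda>(X, r). \<forall>x\<in>X. \<forall>y\<in>X. (r (x, y), r (y, x)) \<in> M t \<times> M t)"
    by (auto simp: fun_eq_iff)
  then show ?thesis unfolding M_Cat_def unit_Cat_S_def by simp
qed

theorem theorem4p7:
  fixes U :: "'u set set" and t :: "real \<Rightarrow> real \<Rightarrow> real"
  assumes "set_universe U" and "continuous_t_norm t"
  shows "(\<forall>A. stable_subconstruct A (unit_Cat U t) \<longrightarrow>
            (cartesian_closed A \<longleftrightarrow>
              (\<exists>S. suitable t S \<and> S \<subseteq> M t \<times> M t \<and> A = unit_Cat_S U t S))) \<and>
         stable_subconstruct (M_Cat U t) (unit_Cat U t) \<and> cartesian_closed (M_Cat U t) \<and>
         (\<forall>A. stable_subconstruct A (unit_Cat U t) \<and> cartesian_closed A \<longrightarrow>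
            subconstruct A (M_Cat U t))"
proof -
  interpret enrichment U t
    by unfold_locales (rule assms)+
  have closed: "cartesian_closed (unit_Cat_S U t S)" if "suitable t S" "S \<subseteq> M t \<times> M t" for S
  proof -
    interpret closed_enrichment U t S by unfold_locales (rule that)+
    show ?thesis by (rule cartesian_closed_C)
  qed
  have ex_S: "\<exists>S. suitable t S \<and> S \<subseteq> M t \<times> M t \<and> A = unit_Cat_S U t S"
    if stable: "stable_subconstruct A (unit_Cat U t)" and cc: "cartesian_closed A" for A
  proof -
    interpret stable U t A by unfold_locales (rule stable)
    obtain S where S: "suitable t S" "A = unit_Cat_S U t S" using ex_suitable by blast
    interpret suitable_enrichment U t S by unfold_locales (rule S)
    show ?thesis using S cartesian_closed_imp_subset_M cc by blast
  qed
  interpret MM: suitable_enrichment U t "M t \<times> M t"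
    by unfold_locales (rule suitable_M)
  have "subconstruct A (M_Cat U t)"
    if stable: "stable_subconstruct A (unit_Cat U t)" and cc: "cartesian_closed A" for A
  proof -
    obtain S where S: "S \<subseteq> M t \<times> M t" "A = unit_Cat_S U t S" using ex_S[OF stable cc] by blast
    have "Obj A \<subseteq> Obj (M_Cat U t)"
      unfolding S(2) M_Cat_eq using S_metric_mono[OF _ S(1)] by (auto simp: Obj_unit_Cat_S')
    then show ?thesis
      unfolding subconstruct_def S(2) M_Cat_eq
      by (auto simp: Hom_unit_Cat_S is_construct_unit_Cat_S)
  qed
  then show ?thesis
    using closed ex_S MM.stable_C closed[OF suitable_M order_refl]
    unfolding M_Cat_eq by blast
qed

end
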